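(* Let $\mathcal{C}$ be a class of (finitely presented) groups and let $\mathcal{FEC}$ be the class of finite extensions of groups in $\mathcal{C}$. Then all groups in $\mathcal{C}$ are $\mathrm{Via}$-twisted conjugacy separable if and only if all groups in $\mathcal{FEC}$ are conjugacy separable.
   Context: All groups are assumed finitely presented. A finite extension of a group $H$ is a group $G$ having $H$ as a normal subgroup of finite index. The profinite topology on a group $G$ has as basis the cosets of finite index subgroups of $G$; a subset of $G$ is separable if it is closed in the profinite topology. Maps are written on the right. A group $G$ is conjugacy separable if for every $x\in G$ the conjugacy class $\{z^{-1}xz\mid z\in G\}$ is separable. An automorphism $\phi$ of $G$ is virtually inner if $\phi^k$ is an inner automorphism for some $k>0$; $\mathrm{Via}(G)$ is the set of virtually inner automorphisms of $G$. A group $G$ is $\mathrm{Via}$-twisted conjugacy separable if for every $\phi\in\mathrm{Via}(G)$ and every $x\in G$ the $\phi$-twisted conjugacy class $\{(z^{-1}\phi)xz\mid z\in G\}$ is separable in $G$ (equivalently, the union of the $\phi$-twisted conjugacy classes of the elements of any finite set is separable). *)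

theory Defs
  imports "HOL-Analysis.Abstract_Topology" "HOL-Algebra.Coset" "HOL-Algebra.Bij"
begin

section \<open>Finite presentations\<close>

text \<open>A letter is a generator together with an exponent sign (\<open>True\<close> for the generator itself,
  \<open>False\<close> for its inverse). The relation \<open>pres_eq X R\<close> below is the least congruence on words
  over \<open>X\<close> that identifies each \<open>x x\<inverse>\<close>, each \<open>x\<inverse> x\<close> and each relator in \<open>R\<close> with the empty word, so
  its classes are the elements of the group with presentation \<open>\<langle>X | R\<rangle>\<close>.\<close>

type_synonym 'x word = "('x \<times> bool) list"

definition words :: "'x set \<Rightarrow> 'x word set"
  where "words X = lists (X \<times> UNIV)"

inductive pres_eq :: "'x set \<Rightarrow> 'x word set \<Rightarrow> 'x word \<Rightarrow> 'x word \<Rightarrow> bool"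
  for X :: "'x set" and R :: "'x word set"
where
  refl: "w \<in> words X \<Longrightarrow> pres_eq X R w w"
| sym: "pres_eq X R v w \<Longrightarrow> pres_eq X R w v"
| trans: "pres_eq X R u v \<Longrightarrow> pres_eq X R v w \<Longrightarrow> pres_eq X R u w"
| cancel: "u \<in> words X \<Longrightarrow> v \<in> words X \<Longrightarrow> x \<in> X \<Longrightarrow>
    pres_eq X R (u @ [(x, b), (x, \<not> b)] @ v) (u @ v)"
| relator: "u \<in> words X \<Longrightarrow> v \<in> words X \<Longrightarrow> r \<in> R \<inter> words X \<Longrightarrow>
    pres_eq X R (u @ r @ v) (u @ v)"

definition presented_group :: "'x set \<Rightarrow> 'x word set \<Rightarrow> 'x word set monoid"
  where "presented_group X R =
    \<lparr>carrier = words X // {(v, w). pres_eq X R v w},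
     mult = (\<lambda>A B. {w. \<exists>a\<in>A. \<exists>b\<in>B. pres_eq X R (a @ b) w}),
     one = {w. pres_eq X R [] w}\<rparr>"

definition finitely_presented :: "'a monoid \<Rightarrow> bool"
  where "finitely_presented G \<longleftrightarrow> group G \<and>
    (\<exists>(X :: nat set) R. finite X \<and> finite R \<and> R \<subseteq> words X \<and> G \<cong> presented_group X R)"

lemma pres_eq_words: "pres_eq X R v w \<Longrightarrow> v \<in> words X \<and> w \<in> words X"
  by (induction rule: pres_eq.induct) (auto simp: words_def)

lemma equiv_pres_eq: "equiv (words X) {(v, w). pres_eq X R v w}"
proof (rule equivI)
  show "{(v, w). pres_eq X R v w} \<subseteq> words X \<times> words X" by (auto dest: pres_eq_words)
  show "refl_on (words X) {(v, w). pres_eq X R v w}" by (auto simp: refl_on_def intro: pres_eq.refl)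
  show "sym {(v, w). pres_eq X R v w}" by (auto simp: sym_def intro: pres_eq.sym)
  show "trans {(v, w). pres_eq X R v w}" unfolding trans_def by (blast intro: pres_eq.trans)
qed

lemma pres_eq_context:
  assumes "pres_eq X R v w" "p \<in> words X" "q \<in> words X"
  shows "pres_eq X R (p @ v @ q) (p @ w @ q)"
  using assms
proof (induction rule: pres_eq.induct)
  case (refl w) then show ?case by (auto simp: words_def intro: pres_eq.refl)
next
  case (sym v w) then show ?case by (simp add: pres_eq.sym)
next
  case (trans u v w) then show ?case by (blast intro: pres_eq.trans)
next
  case (cancel u v x b)
  then show ?case using pres_eq.cancel[of "p @ u" X "v @ q" x R b] by (auto simp: words_def)
next
  case (relator u v r)
  then show ?case using pres_eq.relator[of "p @ u" X "v @ q" r R] by (auto simp: words_def)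
qed

lemma pres_eq_append:
  assumes "pres_eq X R a a'" "pres_eq X R b b'"
  shows "pres_eq X R (a @ b) (a' @ b')"
proof -
  note m = assms[THEN pres_eq_words]
  have "pres_eq X R (a @ b) (a' @ b)"
    using pres_eq_context[OF assms(1), of "[]" b] m by (auto simp: words_def)
  moreover have "pres_eq X R (a' @ b) (a' @ b')"
    using pres_eq_context[OF assms(2), of a' "[]"] m by (auto simp: words_def)
  ultimately show ?thesis by (rule pres_eq.trans)
qed

lemma pres_eq_inverse:
  "w \<in> words X \<Longrightarrow> pres_eq X R (rev (map (\<lambda>(x, b). (x, \<not> b)) w) @ w) []"
proof (induction w)
  case Nil then show ?case by (auto simp: words_def intro: pres_eq.refl)
next
  case (Cons l w)
  obtain x b where l: "l = (x, b)" by (cases l)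
  let ?i = "rev (map (\<lambda>(x, b). (x, \<not> b)) w)"
  have x: "x \<in> X" and w: "w \<in> words X" using Cons.prems by (auto simp: words_def l)
  have "?i \<in> words X" using w by (auto simp: words_def)
  then have "pres_eq X R (?i @ [(x, \<not> b), (x, \<not> \<not> b)] @ w) (?i @ w)"
    using x w by (intro pres_eq.cancel)
  then show ?case using pres_eq.trans[OF _ Cons.IH[OF w]] by (simp add: l)
qed

lemma group_presented_group: "group (presented_group X R)"
proof -
  let ?E = "{(v, w). pres_eq X R v w}"
  let ?P = "presented_group X R"
  let ?c = "\<lambda>w. {w'. pres_eq X R w w'}"
  have car: "carrier ?P = ?c ` words X"
    by (auto simp: presented_group_def quotient_def)
  have mult: "?c a \<otimes>\<^bsub>?P\<^esub> ?c b = ?c (a @ b)" if "a \<in> words X" "b \<in> words X" for a b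
  proof -
    have "(\<exists>a'\<in>?c a. \<exists>b'\<in>?c b. pres_eq X R (a' @ b') w) \<longleftrightarrow> pres_eq X R (a @ b) w" for w
    proof
      assume "\<exists>a'\<in>?c a. \<exists>b'\<in>?c b. pres_eq X R (a' @ b') w"
      then obtain a' b' where
        "pres_eq X R a a'" "pres_eq X R b b'" "pres_eq X R (a' @ b') w" by blast
      then show "pres_eq X R (a @ b) w" by (metis pres_eq_append pres_eq.trans)
    next
      assume "pres_eq X R (a @ b) w"
      then show "\<exists>a'\<in>?c a. \<exists>b'\<in>?c b. pres_eq X R (a' @ b') w"
        using that[THEN pres_eq.refl[of _ X R]] by blast
    qed
    then show ?thesis by (simp add: presented_group_def)
  qed
  have one: "\<one>\<^bsub>?P\<^esub> = ?c []" by (simp add: presented_group_def)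
  have nil: "[] \<in> words X" and app: "\<And>a b. a \<in> words X \<Longrightarrow> b \<in> words X \<Longrightarrow> a @ b \<in> words X"
    by (auto simp: words_def)
  show ?thesis
  proof (rule groupI)
    fix A B assume "A \<in> carrier ?P" "B \<in> carrier ?P"
    then show "A \<otimes>\<^bsub>?P\<^esub> B \<in> carrier ?P" by (auto simp: car mult app)
  next
    show "\<one>\<^bsub>?P\<^esub> \<in> carrier ?P" using nil by (auto simp: car one)
  next
    fix A B C assume "A \<in> carrier ?P" "B \<in> carrier ?P" "C \<in> carrier ?P"
    then show "A \<otimes>\<^bsub>?P\<^esub> B \<otimes>\<^bsub>?P\<^esub> C = A \<otimes>\<^bsub>?P\<^esub> (B \<otimes>\<^bsub>?P\<^esub> C)"
      by (auto simp: car mult app)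
  next
    fix A assume "A \<in> carrier ?P"
    then show "\<one>\<^bsub>?P\<^esub> \<otimes>\<^bsub>?P\<^esub> A = A" using nil by (auto simp: car mult one)
  next
    fix A assume "A \<in> carrier ?P"
    then obtain w where w: "w \<in> words X" "A = ?c w" by (auto simp: car)
    let ?i = "rev (map (\<lambda>(x, b). (x, \<not> b)) w)"
    have i: "?i \<in> words X" using w by (auto simp: words_def)
    have "?c (?i @ w) = ?c []"
      using pres_eq_inverse[OF w(1), of R]
      by (metis (no_types, lifting) pres_eq.trans pres_eq.sym)
    then show "\<exists>B\<in>carrier ?P. B \<otimes>\<^bsub>?P\<^esub> A = \<one>\<^bsub>?P\<^esub>"
      using i w by (intro bexI[of _ "?c ?i"]) (auto simp: car mult one)
  qed
qed


section \<open>Separability\<close>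

text \<open>The cosets of finite index subgroups are given to \<^const>\<open>topology_generated_by\<close> as a subbasis;
  they form a basis, as shown below. Right cosets suffice, because a left coset of \<open>H\<close> is a right
  coset of a conjugate of \<open>H\<close>.\<close>

definition finite_index :: "'a set \<Rightarrow> 'a monoid \<Rightarrow> bool"
  where "finite_index H G \<longleftrightarrow> subgroup H G \<and> finite (rcosets\<^bsub>G\<^esub> H)"

definition profinite_topology :: "'a monoid \<Rightarrow> 'a topology"
  where "profinite_topology G =
    topology_generated_by {H #>\<^bsub>G\<^esub> g |H g. finite_index H G \<and> g \<in> carrier G}"

definition separable :: "'a monoid \<Rightarrow> 'a set \<Rightarrow> bool"
  where "separable G S \<longleftrightarrow> closedin (profinite_topology G) S"

lemma finite_index_Int:
  fixes G :: "'a monoid" (structure)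
  assumes "group G" "finite_index H G" "finite_index K G"
  shows "finite_index (H \<inter> K) G"
proof -
  interpret group G by fact
  have H: "subgroup H G" and K: "subgroup K G"
    using assms by (auto simp: finite_index_def)
  have HK: "subgroup (H \<inter> K) G" using subgroups_Inter_pair[OF H K] .
  have eq: "(H \<inter> K) #> x = (H #> x) \<inter> (K #> x)" if "x \<in> carrier G" for x
  proof
    show "(H #> x) \<inter> (K #> x) \<subseteq> (H \<inter> K) #> x"
    proof
      fix y assume "y \<in> (H #> x) \<inter> (K #> x)"
      then obtain h k where "h \<in> H" "k \<in> K" "y = h \<otimes> x" "y = k \<otimes> x"
        by (auto simp: r_coset_def)
      moreover from this have "h = k"
        using that H K by (metis right_cancel subgroup.mem_carrier)
      ultimately show "y \<in> (H \<inter> K) #> x" by (auto simp: r_coset_def)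
    qed
  qed (auto simp: r_coset_def)
  have "rcosets (H \<inter> K) \<subseteq> (\<lambda>(A, B). A \<inter> B) ` ((rcosets H) \<times> (rcosets K))"
  proof
    fix A assume "A \<in> rcosets (H \<inter> K)"
    then obtain x where "x \<in> carrier G" "A = (H #> x) \<inter> (K #> x)"
      by (auto simp: RCOSETS_def eq)
    then show "A \<in> (\<lambda>(A, B). A \<inter> B) ` ((rcosets H) \<times> (rcosets K))"
      by (intro image_eqI[of _ _ "(H #> x, K #> x)"]) (auto simp: RCOSETS_def)
  qed
  moreover have "finite ((rcosets H) \<times> (rcosets K))"
    using assms by (auto simp: finite_index_def)
  ultimately show ?thesis
    using HK by (auto simp: finite_index_def intro: finite_subset)
qed

lemma openin_profinite_topology_iff:
  fixes G :: "'a monoid" (structure)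
  assumes "group G"
  shows "openin (profinite_topology G) U \<longleftrightarrow>
    U \<subseteq> carrier G \<and> (\<forall>x\<in>U. \<exists>H. finite_index H G \<and> H #>\<^bsub>G\<^esub> x \<subseteq> U)"
proof -
  interpret group G by fact
  let ?B = "{H #> g |H g. finite_index H G \<and> g \<in> carrier G}"
  have "U \<subseteq> carrier G \<and> (\<forall>x\<in>U. \<exists>H. finite_index H G \<and> H #> x \<subseteq> U)"
    if "generate_topology_on ?B U"
    using that
  proof (induction rule: generate_topology_on.induct)
    case Empty then show ?case by simp
  next
    case (Int a b)
    have "\<exists>H. finite_index H G \<and> H #> x \<subseteq> a \<inter> b" if "x \<in> a \<inter> b" for x
    proof -
      have "x \<in> a" "x \<in> b" using that by auto
      then obtain H K
        where HK: "finite_index H G" "H #> x \<subseteq> a" "finite_index K G" "K #> x \<subseteq> b"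
        using Int.IH by meson
      have "(H \<inter> K) #> x \<subseteq> (H #> x) \<inter> (K #> x)" unfolding r_coset_def by blast
      then have "(H \<inter> K) #> x \<subseteq> a \<inter> b" using HK(2,4) by blast
      then show ?thesis using finite_index_Int[OF assms HK(1,3)] by blast
    qed
    moreover have "a \<inter> b \<subseteq> carrier G" using Int.IH by blast
    ultimately show ?case by simp
  next
    case (UN K)
    have "\<exists>H. finite_index H G \<and> H #> x \<subseteq> \<Union>K" if x: "x \<in> \<Union>K" for x
    proof -
      obtain k where k: "k \<in> K" "x \<in> k" using x by blast
      then obtain H where "finite_index H G" "H #> x \<subseteq> k" using UN.IH[OF k(1)] by blast
      then show ?thesis using k by blast
    qed
    moreover have "\<Union>K \<subseteq> carrier G" using UN.IH by blast
    ultimately show ?case by blast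
  next
    case (Basis s)
    then obtain H g where s: "s = H #> g" "finite_index H G" "g \<in> carrier G" by auto
    then have H: "subgroup H G" by (simp add: finite_index_def)
    then have "H #> x = s" if "x \<in> s" for x
      using repr_independence[of x H g] that s by simp
    moreover have "s \<subseteq> carrier G" using s H by (simp add: r_coset_subset_G subgroup.subset)
    ultimately show ?case using s(2) by (metis order_refl)
  qed
  moreover have "generate_topology_on ?B U"
    if U: "U \<subseteq> carrier G" "\<forall>x\<in>U. \<exists>H. finite_index H G \<and> H #> x \<subseteq> U"
  proof -
    have "U = \<Union>{A \<in> ?B. A \<subseteq> U}"
    proof
      show "U \<subseteq> \<Union>{A \<in> ?B. A \<subseteq> U}"
      proof
        fix x assume x: "x \<in> U"
        then obtain H where H: "finite_index H G" "H #> x \<subseteq> U" using U by blast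
        moreover have "x \<in> H #> x"
          using H x U by (auto simp: finite_index_def intro: rcos_self)
        ultimately show "x \<in> \<Union>{A \<in> ?B. A \<subseteq> U}" using x U by blast
      qed
    qed blast
    moreover have "generate_topology_on ?B (\<Union>{A \<in> ?B. A \<subseteq> U})"
      by (rule generate_topology_on.UN) (rule generate_topology_on.Basis, blast)
    ultimately show ?thesis by simp
  qed
  ultimately show ?thesis
    unfolding profinite_topology_def openin_topology_generated_by_iff by blast
qed

definition conjugacy_separable :: "'a monoid \<Rightarrow> bool"
  where "conjugacy_separable G \<longleftrightarrow>
    (\<forall>x\<in>carrier G. separable G {inv\<^bsub>G\<^esub> z \<otimes>\<^bsub>G\<^esub> x \<otimes>\<^bsub>G\<^esub> z |z. z \<in> carrier G})"

definition inner_on :: "'a monoid \<Rightarrow> ('a \<Rightarrow> 'a) \<Rightarrow> bool"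
  where "inner_on G f \<longleftrightarrow>
    (\<exists>g\<in>carrier G. \<forall>x\<in>carrier G. f x = inv\<^bsub>G\<^esub> g \<otimes>\<^bsub>G\<^esub> x \<otimes>\<^bsub>G\<^esub> g)"

definition Via :: "'a monoid \<Rightarrow> ('a \<Rightarrow> 'a) set"
  where "Via G = {\<phi> \<in> auto G. \<exists>k>0. inner_on G (\<phi> ^^ k)}"

definition twisted_conjugacy_class :: "'a monoid \<Rightarrow> ('a \<Rightarrow> 'a) \<Rightarrow> 'a \<Rightarrow> 'a set"
  where "twisted_conjugacy_class G \<phi> x =
    {\<phi> (inv\<^bsub>G\<^esub> z) \<otimes>\<^bsub>G\<^esub> x \<otimes>\<^bsub>G\<^esub> z |z. z \<in> carrier G}"

definition Via_twisted_conjugacy_separable :: "'a monoid \<Rightarrow> bool"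
  where "Via_twisted_conjugacy_separable G \<longleftrightarrow>
    (\<forall>\<phi>\<in>Via G. \<forall>x\<in>carrier G. separable G (twisted_conjugacy_class G \<phi> x))"


section \<open>Finite extensions\<close>

text \<open>Groups are taken up to isomorphism: \<open>H\<close> need only be isomorphic to a normal subgroup of
  finite index of \<open>G\<close>. No finite presentability of \<open>G\<close> is demanded, since a finite extension of a
  finitely presented group is finitely presented.\<close>

definition finite_extension :: "'b monoid \<Rightarrow> 'a monoid \<Rightarrow> bool"
  where "finite_extension G H \<longleftrightarrow> group G \<and>
    (\<exists>N. N \<lhd> G \<and> finite_index N G \<and> G\<lparr>carrier := N\<rparr> \<cong> H)"

text \<open>The members of the class \<open>FEC C\<close> are groups on a type \<open>'b\<close> of their own. If \<open>'b\<close> is infinite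
  and the members of \<open>C\<close> are finitely presented, then all their finite extensions are
  countable, so every one of them is represented, up to isomorphism, by a group on \<open>'b\<close>.\<close>

definition FEC :: "'a monoid set \<Rightarrow> 'b monoid set"
  where "FEC C = {G. \<exists>H\<in>C. finite_extension G H}"

end

theory Submission
  imports Defs "HOL-Algebra.Weak_Morphisms"
begin

text \<open>
  Both directions rest on one dictionary. Let \<open>H\<close> be a normal subgroup of finite index of \<open>G\<close>, let
  \<open>y \<in> G\<close>, and let \<open>\<phi>\<close> be the automorphism \<open>z \<mapsto> y\<inverse> z y\<close> of \<open>H\<close>. Since \<open>z y = y \<phi>(z)\<close>, one has
  \<open>\<phi>(z)\<inverse> (x y) \<phi>(z) = (\<phi>(z\<inverse>) x z) y\<close>, so the right translation by \<open>y\<close> carries the \<open>\<phi>\<close>-twisted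
  conjugacy class of \<open>x\<close> in \<open>H\<close> onto the orbit of \<open>x y\<close> under conjugation by \<open>H\<close>. Right
  translations are homeomorphisms of the profinite topology, and \<open>H\<close> is an open and closed
  subgroup whose own profinite topology is the one induced from \<open>G\<close>. Separability therefore passes
  between the twisted class and the orbit.

  Suppose first that \<open>H\<close> is \<open>Via\<close>-twisted conjugacy separable. Some power of \<open>y\<close> lies in \<open>H\<close>, so \<open>\<phi>\<close>
  is virtually inner, and every orbit of \<open>H\<close> on \<open>G\<close> is separable
  (\<open>separable_orbit_normal_subgroup\<close>). A conjugacy class of \<open>G\<close> is a union of finitely many such
  orbits, one for each coset of \<open>H\<close>.

  Conversely, let \<open>\<phi>\<close> be virtually inner. It has to be realised as conjugation by an element \<open>t\<close> of a
  finite extension of \<open>H\<close>. If \<open>\<phi>\<^sup>k\<close> is conjugation by \<open>g\<close>, the relation \<open>t\<^sup>k = g\<close> is consistent only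
  when \<open>\<phi>\<close> fixes \<open>g\<close>, and in general \<open>\<phi>\<close> multiplies \<open>g\<close> by a central element. The product
  \<open>h = g \<phi>(g) \<dots> \<phi>\<^sup>k\<^sup>-\<^sup>1(g)\<close> repairs this: it is fixed by \<open>\<phi>\<close>, and \<open>\<phi>\<close> to the power \<open>m = k\<^sup>2\<close> is
  conjugation by \<open>h\<close> (\<open>Via_power_conj_fixed\<close>). So there is a group \<open>E\<close> generated by \<open>H\<close> and \<open>t\<close>, with
  \<open>t\<^sup>m = h\<close>, in which \<open>H\<close> is normal of index \<open>m\<close> (\<open>cyclic_extension\<close>). There the orbit of \<open>x t\<close> under
  \<open>H\<close> is its entire conjugacy class, because \<open>E\<close> is the product of \<open>H\<close> with the powers of \<open>x t\<close>, which
  centralise \<open>x t\<close>. Conjugacy separability of \<open>E\<close> thus yields separability of the twisted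
  class. Being finitely presented, \<open>H\<close> is countable, and so is \<open>E\<close>; a copy of \<open>E\<close> can therefore be
  placed on any given infinite type.
\<close>

section \<open>Continuity in the profinite topology\<close>

lemma topspace_profinite_topology [simp]:
  assumes "group G"
  shows "topspace (profinite_topology G) = carrier G"
proof
  interpret group G by fact
  have "rcosets\<^bsub>G\<^esub> (carrier G) = {carrier G}"
    by (auto simp: RCOSETS_def coset_join2 subgroup_self)
  then have "finite_index (carrier G) G"
    by (simp add: finite_index_def subgroup_self)
  then have "openin (profinite_topology G) (carrier G)"
    using subgroup_self
    by (auto simp: openin_profinite_topology_iff[OF assms] coset_join2)
  then show "carrier G \<subseteq> topspace (profinite_topology G)" by (rule openin_subset)
  show "topspace (profinite_topology G) \<subseteq> carrier G"
    using openin_topspace openin_profinite_topology_iff[OF assms] by blast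
qed

text \<open>The right cosets of the preimage of \<open>L\<close> are preimages of right cosets of \<open>L\<close>, so there
  are at most as many of them.\<close>

lemma finite_index_vimage:
  assumes "group G" "group H" "f \<in> hom G H" "finite_index L H"
  shows "finite_index {x \<in> carrier G. f x \<in> L} G"
proof -
  interpret group_hom G H f
    using assms by (simp add: group_hom_def group_hom_axioms_def)
  interpret L: subgroup L H using assms by (simp add: finite_index_def)
  let ?P = "{x \<in> carrier G. f x \<in> L}"
  have P: "subgroup ?P G" by unfold_locales auto
  have "?P #>\<^bsub>G\<^esub> x = {y \<in> carrier G. f y \<in> L #>\<^bsub>H\<^esub> f x}" if x: "x \<in> carrier G" for x
  proof -
    have "y \<in> ?P #>\<^bsub>G\<^esub> x \<longleftrightarrow> f y \<in> L #>\<^bsub>H\<^esub> f x" if y: "y \<in> carrier G" for y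
      using x y by (simp add: subgroup.rcos_module[OF P] L.rcos_module assms(1,2))
    moreover have "?P #>\<^bsub>G\<^esub> x \<subseteq> carrier G"
      using x by (intro G.r_coset_subset_G) auto
    ultimately show ?thesis by blast
  qed
  then have "rcosets\<^bsub>G\<^esub> ?P = (\<lambda>x. {y \<in> carrier G. f y \<in> L #>\<^bsub>H\<^esub> f x}) ` carrier G"
    by (auto simp: RCOSETS_def)
  also have "\<dots> \<subseteq> (\<lambda>A. {y \<in> carrier G. f y \<in> A}) ` (rcosets\<^bsub>H\<^esub> L)"
    unfolding RCOSETS_def by (rule image_subsetI, rule image_eqI[OF HOL.refl]) auto
  finally have "rcosets\<^bsub>G\<^esub> ?P \<subseteq> (\<lambda>A. {y \<in> carrier G. f y \<in> A}) ` (rcosets\<^bsub>H\<^esub> L)" .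
  then show ?thesis
    using P assms(4) by (auto simp: finite_index_def intro: finite_subset)
qed

lemma continuous_map_profinite_hom:
  assumes "group G" "group H" "f \<in> hom G H"
  shows "continuous_map (profinite_topology G) (profinite_topology H) f"
  unfolding continuous_map_def
proof (intro conjI allI impI)
  interpret group_hom G H f
    using assms by (simp add: group_hom_def group_hom_axioms_def)
  show "f \<in> topspace (profinite_topology G) \<rightarrow> topspace (profinite_topology H)"
    using assms by auto
  fix U assume "openin (profinite_topology H) U"
  then have U: "\<And>y. y \<in> U \<Longrightarrow> \<exists>L. finite_index L H \<and> L #>\<^bsub>H\<^esub> y \<subseteq> U"
    by (simp add: openin_profinite_topology_iff assms)
  have "\<exists>K. finite_index K G \<and> K #>\<^bsub>G\<^esub> x \<subseteq> {x \<in> carrier G. f x \<in> U}"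
    if x: "x \<in> carrier G" "f x \<in> U" for x
  proof -
    obtain L where L: "finite_index L H" "L #>\<^bsub>H\<^esub> f x \<subseteq> U" using U x by blast
    have "{z \<in> carrier G. f z \<in> L} #>\<^bsub>G\<^esub> x \<subseteq> {x \<in> carrier G. f x \<in> U}"
      using L(2) x by (auto simp: r_coset_def)
    then show ?thesis using finite_index_vimage[OF assms L(1)] by blast
  qed
  then show "openin (profinite_topology G) {x \<in> topspace (profinite_topology G). f x \<in> U}"
    by (simp add: openin_profinite_topology_iff assms)
qed

lemma continuous_map_profinite_right_mult:
  fixes G :: "'a monoid" (structure)
  assumes "group G" and g: "g \<in> carrier G"
  shows "continuous_map (profinite_topology G) (profinite_topology G) (\<lambda>x. x \<otimes> g)"
  unfolding continuous_map_def
proof (intro conjI allI impI)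
  interpret group G by fact
  show "(\<lambda>x. x \<otimes> g) \<in> topspace (profinite_topology G) \<rightarrow> topspace (profinite_topology G)"
    using assms by auto
  fix U assume "openin (profinite_topology G) U"
  then have U: "\<And>y. y \<in> U \<Longrightarrow> \<exists>L. finite_index L G \<and> L #> y \<subseteq> U"
    by (simp add: openin_profinite_topology_iff assms)
  have "\<exists>K. finite_index K G \<and> K #> x \<subseteq> {x \<in> carrier G. x \<otimes> g \<in> U}"
    if x: "x \<in> carrier G" "x \<otimes> g \<in> U" for x
  proof -
    obtain L where L: "finite_index L G" "L #> (x \<otimes> g) \<subseteq> U" using U x by blast
    then have "L \<subseteq> carrier G" by (auto simp: finite_index_def dest: subgroup.subset)
    then have "L #> x \<subseteq> {x \<in> carrier G. x \<otimes> g \<in> U}"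
    proof (intro subsetI)
      fix y assume "y \<in> L #> x"
      then obtain l where l: "l \<in> L" "y = l \<otimes> x" by (auto simp: r_coset_def)
      then have "l \<in> carrier G" using \<open>L \<subseteq> carrier G\<close> by blast
      moreover have "l \<otimes> (x \<otimes> g) \<in> U" using L(2) l by (auto simp: r_coset_def)
      ultimately show "y \<in> {x \<in> carrier G. x \<otimes> g \<in> U}"
        using x g l by (simp add: m_assoc)
    qed
    then show ?thesis using L by blast
  qed
  then show "openin (profinite_topology G) {x \<in> topspace (profinite_topology G). x \<otimes> g \<in> U}"
    by (simp add: openin_profinite_topology_iff assms)
qed

text \<open>This is transitivity of finite index. Each coset of \<open>\<iota> ` K\<close> is determined by a coset of \<open>K\<close>
  in \<open>H\<close> and a coset of \<open>\<iota> ` carrier H\<close> in \<open>G\<close>: translate the image of the former by a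
  representative of the latter.\<close>

lemma finite_index_image:
  assumes "group H" "group G" "\<iota> \<in> hom H G"
    and img: "finite_index (\<iota> ` carrier H) G" and K: "finite_index K H"
  shows "finite_index (\<iota> ` K) G"
proof -
  interpret group_hom H G \<iota>
    using assms by (simp add: group_hom_def group_hom_axioms_def)
  let ?N = "\<iota> ` carrier H"
  have N: "subgroup ?N G" using img by (simp add: finite_index_def)
  have Ks: "subgroup K H" using K by (simp add: finite_index_def)
  then have Kc: "K \<subseteq> carrier H" by (rule subgroup.subset)
  have sub: "subgroup (\<iota> ` K) G" using subgroup_img_is_subgroup[OF Ks] .
  have "rcosets\<^bsub>G\<^esub> (\<iota> ` K) \<subseteq>
    (\<lambda>(A, B). \<iota> ` A #>\<^bsub>G\<^esub> (SOME r. r \<in> B)) ` ((rcosets\<^bsub>H\<^esub> K) \<times> (rcosets\<^bsub>G\<^esub> ?N))"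
  proof
    fix X assume "X \<in> rcosets\<^bsub>G\<^esub> (\<iota> ` K)"
    then obtain x where x: "x \<in> carrier G" "X = \<iota> ` K #>\<^bsub>G\<^esub> x" by (auto simp: RCOSETS_def)
    let ?B = "?N #>\<^bsub>G\<^esub> x"
    define r where "r = (SOME r. r \<in> ?B)"
    have xB: "x \<in> ?B" using H.rcos_self x N by blast
    then have r: "r \<in> ?B" unfolding r_def by (rule someI)
    then have rc: "r \<in> carrier G"
      using H.r_coset_subset_G[OF subgroup.subset[OF N] x(1)] by blast
    have "x \<in> ?N #>\<^bsub>G\<^esub> r" using xB H.repr_independence[OF r x(1) N] by simp
    then obtain n where n: "n \<in> carrier H" "x = \<iota> n \<otimes>\<^bsub>G\<^esub> r"
      by (auto simp: r_coset_def)
    have eq: "\<iota> ` (K #>\<^bsub>H\<^esub> n) = \<iota> ` K #>\<^bsub>G\<^esub> \<iota> n"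
      using n Kc by (auto simp: r_coset_def image_UN subset_iff)
    have X: "X = \<iota> ` (K #>\<^bsub>H\<^esub> n) #>\<^bsub>G\<^esub> r"
      unfolding eq x(2) n(2)
      by (rule H.coset_mult_assoc[symmetric, OF subgroup.subset[OF sub] hom_closed[OF n(1)] rc])
    have "(K #>\<^bsub>H\<^esub> n, ?B) \<in> (rcosets\<^bsub>H\<^esub> K) \<times> (rcosets\<^bsub>G\<^esub> ?N)"
      using n(1) x(1) unfolding RCOSETS_def by blast
    then show "X \<in> (\<lambda>(A, B). \<iota> ` A #>\<^bsub>G\<^esub> (SOME r. r \<in> B)) `
        ((rcosets\<^bsub>H\<^esub> K) \<times> (rcosets\<^bsub>G\<^esub> ?N))"
      by (rule rev_image_eqI) (simp only: X r_def prod.case)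
  qed
  moreover have "finite ((rcosets\<^bsub>H\<^esub> K) \<times> (rcosets\<^bsub>G\<^esub> ?N))"
    using img K by (simp add: finite_index_def)
  ultimately show ?thesis using sub by (auto simp: finite_index_def intro: finite_subset)
qed

text \<open>A point outside the subgroup \<open>\<iota> ` carrier H\<close> has the whole coset as a neighbourhood that
  avoids \<open>\<iota> ` S\<close>. A point \<open>\<iota> a\<close> with \<open>a \<notin> S\<close> is separated from \<open>\<iota> ` S\<close> by the image of a coset of some
  \<open>K\<close> of finite index in \<open>H\<close>, and \<open>\<iota> ` K\<close> again has finite index in \<open>G\<close>.\<close>

lemma separable_image:
  assumes "group H" "group G" "\<iota> \<in> hom H G" and inj: "inj_on \<iota> (carrier H)"
    and img: "finite_index (\<iota> ` carrier H) G" and S: "separable H S"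
  shows "separable G (\<iota> ` S)"
proof -
  interpret group_hom H G \<iota>
    using assms by (simp add: group_hom_def group_hom_axioms_def)
  let ?N = "\<iota> ` carrier H"
  have N: "subgroup ?N G" using img by (simp add: finite_index_def)
  have Sc: "S \<subseteq> carrier H" and op: "openin (profinite_topology H) (carrier H - S)"
    using S by (auto simp: separable_def closedin_def assms)
  have "\<exists>L. finite_index L G \<and> L #>\<^bsub>G\<^esub> x \<subseteq> carrier G - \<iota> ` S"
    if x: "x \<in> carrier G - \<iota> ` S" for x
  proof (cases "x \<in> ?N")
    case False
    have "(?N #>\<^bsub>G\<^esub> x) \<inter> ?N = {}"
    proof (rule ccontr)
      assume "(?N #>\<^bsub>G\<^esub> x) \<inter> ?N \<noteq> {}"
      then obtain n where "n \<in> ?N" "n \<otimes>\<^bsub>G\<^esub> x \<in> ?N"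
        unfolding r_coset_def by blast
      then have "inv\<^bsub>G\<^esub> n \<otimes>\<^bsub>G\<^esub> (n \<otimes>\<^bsub>G\<^esub> x) \<in> ?N"
        using N by (simp add: subgroup.m_closed subgroup.m_inv_closed)
      moreover have "n \<in> carrier G" using \<open>n \<in> ?N\<close> by auto
      ultimately show False using False x by (simp add: H.m_assoc[symmetric])
    qed
    moreover have "?N #>\<^bsub>G\<^esub> x \<subseteq> carrier G"
      using x by (intro H.r_coset_subset_G) auto
    ultimately show ?thesis using img Sc by blast
  next
    case True
    then obtain a where a: "a \<in> carrier H - S" "x = \<iota> a" using x by blast
    then obtain K where K: "finite_index K H" "K #>\<^bsub>H\<^esub> a \<subseteq> carrier H - S"
      using op by (auto simp: openin_profinite_topology_iff assms)
    have Kc: "K \<subseteq> carrier H" using K by (auto simp: finite_index_def dest: subgroup.subset)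
    have "\<iota> ` K #>\<^bsub>G\<^esub> x = \<iota> ` (K #>\<^bsub>H\<^esub> a)"
      using a Kc by (auto simp: r_coset_def image_UN subset_iff)
    also have "\<dots> \<subseteq> carrier G - \<iota> ` S"
    proof
      fix y assume "y \<in> \<iota> ` (K #>\<^bsub>H\<^esub> a)"
      then obtain b where b: "b \<in> carrier H - S" "y = \<iota> b" using K(2) by blast
      moreover from this have "y \<notin> \<iota> ` S"
        using inj_on_image_mem_iff[OF inj, of b S] Sc by simp
      ultimately show "y \<in> carrier G - \<iota> ` S" by simp
    qed
    finally show ?thesis using finite_index_image[OF assms(1-3) img K(1)] by blast
  qed
  then have "openin (profinite_topology G) (carrier G - \<iota> ` S)"
    by (simp add: openin_profinite_topology_iff assms)
  then show ?thesis using Sc by (auto simp: separable_def closedin_def assms)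
qed

text \<open>Homomorphisms and right translations are both continuous. With \<open>f\<close> an embedding, this
  restricts a closed set to a subgroup; with \<open>f\<close> the identity, it translates a closed set.\<close>

lemma separable_vimage:
  assumes "group G" "group H" "f \<in> hom G H" "g \<in> carrier H" "separable H S"
  shows "separable G {x \<in> carrier G. f x \<otimes>\<^bsub>H\<^esub> g \<in> S}"
proof -
  have "continuous_map (profinite_topology G) (profinite_topology H) ((\<lambda>y. y \<otimes>\<^bsub>H\<^esub> g) \<circ> f)"
    by (intro continuous_map_compose[of _ "profinite_topology H"] continuous_map_profinite_hom
        continuous_map_profinite_right_mult assms)
  from closedin_continuous_map_preimage[OF this] show ?thesis
    using assms by (simp add: separable_def)
qed

section \<open>Finite extensions and automorphisms\<close>

text \<open>Working with an embedding \<open>\<iota>\<close> in place of an abstract isomorphism keeps \<open>H\<close> as the group in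
  which twisted classes are formed, so that nothing has to be restricted to a subgroup structure.\<close>

lemma finite_extension_iff_embedding:
  assumes "group H" "group G"
  shows "finite_extension G H \<longleftrightarrow>
    (\<exists>\<iota>. \<iota> \<in> hom H G \<and> inj_on \<iota> (carrier H) \<and> \<iota> ` carrier H \<lhd> G \<and> finite_index (\<iota> ` carrier H) G)"
proof
  assume "finite_extension G H"
  then obtain N where N: "N \<lhd> G" "finite_index N G" "G\<lparr>carrier := N\<rparr> \<cong> H"
    by (auto simp: finite_extension_def)
  then have sub: "subgroup N G" by (simp add: finite_index_def)
  then have "group (G\<lparr>carrier := N\<rparr>)" using assms by (simp add: subgroup.subgroup_is_group)
  then obtain f where f: "f \<in> iso H (G\<lparr>carrier := N\<rparr>)"
    using N(3) group.iso_sym unfolding is_iso_def by blast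
  then have "f ` carrier H = N" "inj_on f (carrier H)" by (auto simp: iso_def bij_betw_def)
  moreover have "f \<in> hom H G"
    using f subgroup.subset[OF sub] by (auto simp: iso_def hom_def)
  ultimately show "\<exists>\<iota>. \<iota> \<in> hom H G \<and> inj_on \<iota> (carrier H) \<and> \<iota> ` carrier H \<lhd> G \<and>
      finite_index (\<iota> ` carrier H) G"
    using N by blast
next
  assume "\<exists>\<iota>. \<iota> \<in> hom H G \<and> inj_on \<iota> (carrier H) \<and> \<iota> ` carrier H \<lhd> G \<and>
      finite_index (\<iota> ` carrier H) G"
  then obtain f where f: "f \<in> hom H G" "inj_on f (carrier H)"
    and N: "f ` carrier H \<lhd> G" "finite_index (f ` carrier H) G" by blast
  have "f \<in> iso H (G\<lparr>carrier := f ` carrier H\<rparr>)"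
    using f by (auto simp: iso_def hom_def bij_betw_def)
  then have "G\<lparr>carrier := f ` carrier H\<rparr> \<cong> H"
    using assms(1) group.iso_sym unfolding is_iso_def by blast
  then show "finite_extension G H" using assms N by (auto simp: finite_extension_def)
qed

text \<open>By the pigeonhole principle, two of the infinitely many powers of \<open>y\<close> lie in the same coset of
  \<open>N\<close>; their quotient is a power of \<open>y\<close> in \<open>N\<close>.\<close>

lemma ex_pow_mem_finite_index:
  fixes G :: "'a monoid" (structure)
  assumes "group G" "finite_index N G" "y \<in> carrier G"
  shows "\<exists>k>0. y [^] (k::nat) \<in> N"
proof -
  interpret group G by fact
  have N: "subgroup N G" and fin: "finite (rcosets N)"
    using assms by (auto simp: finite_index_def)
  have "range (\<lambda>i::nat. N #> y [^] i) \<subseteq> rcosets N"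
    using assms by (auto simp: RCOSETS_def)
  then have "\<not> inj (\<lambda>i::nat. N #> y [^] i)"
    using fin finite_subset infinite_UNIV_nat finite_imageD by metis
  then obtain i j :: nat where "i < j" and eq: "N #> y [^] j = N #> y [^] i"
    unfolding inj_def by (metis linorder_neqE_nat)
  have "y [^] j \<in> N #> y [^] i"
    using repr_independenceD[OF N _ eq[symmetric]] assms by simp
  then obtain n where n: "n \<in> N" "y [^] j = n \<otimes> y [^] i" unfolding r_coset_def by blast
  have "y [^] (j - i) \<otimes> y [^] i = n \<otimes> y [^] i"
    using n \<open>i < j\<close> assms by (simp add: nat_pow_mult)
  then have "y [^] (j - i) = n" using assms n subgroup.mem_carrier[OF N] by simp
  then have "y [^] (j - i) \<in> N" using n(1) by (simp only:)
  moreover have "j - i > 0" using \<open>i < j\<close> by simp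
  ultimately show ?thesis by (intro exI[of _ "j - i"] conjI)
qed

lemma autoD:
  assumes "\<phi> \<in> auto H"
  shows "\<phi> \<in> hom H H" "bij_betw \<phi> (carrier H) (carrier H)"
  using assms by (auto simp: auto_def Bij_def)

lemma funpow_auto:
  assumes "group H" "\<phi> \<in> auto H"
  shows "(\<phi> ^^ n) \<in> hom H H" "bij_betw (\<phi> ^^ n) (carrier H) (carrier H)"
proof -
  show "bij_betw (\<phi> ^^ n) (carrier H) (carrier H)"
    using bij_betw_funpow[OF autoD(2)[OF assms(2)]] .
  show "(\<phi> ^^ n) \<in> hom H H"
  proof (induction n)
    case 0 then show ?case by (simp add: hom_def)
  next
    case (Suc n)
    then show ?case
      unfolding funpow.simps by (rule Group.hom_compose[OF _ autoD(1)[OF assms(2)]])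
  qed
qed

lemma funpow_conj:
  assumes "group H" "group G" "\<iota> \<in> hom H G" "y \<in> carrier G" "\<phi> \<in> auto H"
    and conj: "\<And>z. z \<in> carrier H \<Longrightarrow> \<iota> (\<phi> z) = inv\<^bsub>G\<^esub> y \<otimes>\<^bsub>G\<^esub> \<iota> z \<otimes>\<^bsub>G\<^esub> y"
    and z: "z \<in> carrier H"
  shows "\<iota> ((\<phi> ^^ n) z) = inv\<^bsub>G\<^esub> (y [^]\<^bsub>G\<^esub> n) \<otimes>\<^bsub>G\<^esub> \<iota> z \<otimes>\<^bsub>G\<^esub> (y [^]\<^bsub>G\<^esub> n)"
proof -
  interpret group_hom H G \<iota>
    using assms by (simp add: group_hom_def group_hom_axioms_def)
  show ?thesis
  proof (induction n)
    case 0 show ?case using z by simp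
  next
    case (Suc n)
    have "(\<phi> ^^ n) z \<in> carrier H" using hom_in_carrier[OF funpow_auto(1)[OF assms(1,5)] z] .
    then have "\<iota> ((\<phi> ^^ Suc n) z) = inv\<^bsub>G\<^esub> y \<otimes>\<^bsub>G\<^esub> \<iota> ((\<phi> ^^ n) z) \<otimes>\<^bsub>G\<^esub> y"
      by (simp add: conj)
    then show ?case using assms(4) z by (simp add: Suc H.inv_mult_group H.m_assoc)
  qed
qed

text \<open>Conjugation by \<open>y\<close> preserves the normal subgroup \<open>\<iota> ` carrier H\<close> and can be pulled back along
  \<open>\<iota>\<close>.\<close>

lemma ex_conj_automorphism:
  assumes "group H" "group G" "\<iota> \<in> hom H G" and inj: "inj_on \<iota> (carrier H)"
    and N: "\<iota> ` carrier H \<lhd> G" and y: "y \<in> carrier G"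
  shows "\<exists>\<phi>\<in>auto H. \<forall>z\<in>carrier H. \<iota> (\<phi> z) = inv\<^bsub>G\<^esub> y \<otimes>\<^bsub>G\<^esub> \<iota> z \<otimes>\<^bsub>G\<^esub> y"
proof -
  interpret group_hom H G \<iota>
    using assms by (simp add: group_hom_def group_hom_axioms_def)
  let ?c = "\<lambda>z. inv\<^bsub>G\<^esub> y \<otimes>\<^bsub>G\<^esub> \<iota> z \<otimes>\<^bsub>G\<^esub> y"
  \<comment> \<open>Members of \<open>auto H\<close> are extensional, hence the restricted abstraction.\<close>
  define \<phi> where "\<phi> = (\<lambda>z\<in>carrier H. inv_into (carrier H) \<iota> (?c z))"
  have c: "?c z \<in> \<iota> ` carrier H" if "z \<in> carrier H" for z
    using that by (intro normal.inv_op_closed1[OF N y] imageI)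
  have \<phi>c: "\<phi> z \<in> carrier H" and \<phi>: "\<iota> (\<phi> z) = ?c z" if "z \<in> carrier H" for z
    using c[OF that] that by (auto simp: \<phi>_def inv_into_into f_inv_into_f)
  have "\<phi> (a \<otimes>\<^bsub>H\<^esub> b) = \<phi> a \<otimes>\<^bsub>H\<^esub> \<phi> b" if ab: "a \<in> carrier H" "b \<in> carrier H" for a b
  proof (rule inj_onD[OF inj])
    have "y \<otimes>\<^bsub>G\<^esub> (inv\<^bsub>G\<^esub> y \<otimes>\<^bsub>G\<^esub> w) = w" if "w \<in> carrier G" for w
      using y that by (simp add: H.m_assoc[symmetric])
    then show "\<iota> (\<phi> (a \<otimes>\<^bsub>H\<^esub> b)) = \<iota> (\<phi> a \<otimes>\<^bsub>H\<^esub> \<phi> b)"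
      using ab y by (simp add: \<phi> \<phi>c H.m_assoc)
  qed (use ab \<phi>c in auto)
  then have "\<phi> \<in> hom H H" using \<phi>c by (auto simp: hom_def)
  moreover have "inj_on \<phi> (carrier H)"
  proof (rule inj_onI)
    fix a b assume ab: "a \<in> carrier H" "b \<in> carrier H" "\<phi> a = \<phi> b"
    then have "?c a = ?c b" using \<phi> by metis
    then have "\<iota> a = \<iota> b" using ab y by simp
    then show "a = b" using ab inj by (simp add: inj_on_eq_iff)
  qed
  moreover have "b \<in> \<phi> ` carrier H" if b: "b \<in> carrier H" for b
  proof -
    have "y \<otimes>\<^bsub>G\<^esub> \<iota> b \<otimes>\<^bsub>G\<^esub> inv\<^bsub>G\<^esub> y \<in> \<iota> ` carrier H"
      using b by (intro normal.inv_op_closed2[OF N y] imageI)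
    then obtain a where a: "a \<in> carrier H" "\<iota> a = y \<otimes>\<^bsub>G\<^esub> \<iota> b \<otimes>\<^bsub>G\<^esub> inv\<^bsub>G\<^esub> y" by (metis imageE)
    have "\<iota> (\<phi> a) = \<iota> b"
      unfolding \<phi>[OF a(1)] a(2) using b y by (simp add: H.m_assoc, simp add: H.m_assoc[symmetric])
    then have "\<phi> a = b" using inj_onD[OF inj _ \<phi>c[OF a(1)] b] by blast
    then show ?thesis using a by blast
  qed
  ultimately have "\<phi> \<in> auto H"
    using \<phi>c by (auto simp: auto_def Bij_def bij_betw_def) (auto simp: \<phi>_def)
  then show ?thesis using \<phi> by blast
qed

section \<open>Conjugacy classes in finite extensions\<close>

text \<open>With \<open>\<phi>\<close> the automorphism of \<open>H\<close> induced by conjugation by \<open>y\<close>, the orbit of \<open>y\<close> is the image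
  of the \<open>\<phi>\<close>-twisted class of the identity, translated by \<open>y\<close>; and \<open>\<phi>\<close> is virtually inner because
  some power of \<open>y\<close> lies in \<open>H\<close>.\<close>

lemma separable_orbit_normal_subgroup:
  assumes "group H" "group G" "\<iota> \<in> hom H G" and inj: "inj_on \<iota> (carrier H)"
    and N: "\<iota> ` carrier H \<lhd> G" and fin: "finite_index (\<iota> ` carrier H) G"
    and sep: "Via_twisted_conjugacy_separable H" and y: "y \<in> carrier G"
  shows "separable G {inv\<^bsub>G\<^esub> n \<otimes>\<^bsub>G\<^esub> y \<otimes>\<^bsub>G\<^esub> n |n. n \<in> \<iota> ` carrier H}"
proof -
  interpret group_hom H G \<iota>
    using assms by (simp add: group_hom_def group_hom_axioms_def)
  obtain \<phi> where aut: "\<phi> \<in> auto H"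
    and \<phi>: "\<And>z. z \<in> carrier H \<Longrightarrow> \<iota> (\<phi> z) = inv\<^bsub>G\<^esub> y \<otimes>\<^bsub>G\<^esub> \<iota> z \<otimes>\<^bsub>G\<^esub> y"
    using ex_conj_automorphism[OF assms(1-5) y] by blast
  have \<phi>c: "\<phi> z \<in> carrier H" if "z \<in> carrier H" for z
    using hom_in_carrier[OF autoD(1)[OF aut] that] .
  obtain k :: nat and g where k: "k > 0" and g: "g \<in> carrier H" "y [^]\<^bsub>G\<^esub> k = \<iota> g"
    using ex_pow_mem_finite_index[OF assms(2) fin y] by blast
  have "(\<phi> ^^ k) x = inv\<^bsub>H\<^esub> g \<otimes>\<^bsub>H\<^esub> x \<otimes>\<^bsub>H\<^esub> g" if x: "x \<in> carrier H" for x
  proof (rule inj_onD[OF inj])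
    show "\<iota> ((\<phi> ^^ k) x) = \<iota> (inv\<^bsub>H\<^esub> g \<otimes>\<^bsub>H\<^esub> x \<otimes>\<^bsub>H\<^esub> g)"
      using funpow_conj[OF assms(1-3) y aut \<phi> x, of k] g x by simp
    show "(\<phi> ^^ k) x \<in> carrier H" using hom_in_carrier[OF funpow_auto(1)[OF assms(1) aut] x] .
  qed (use x g in simp)
  then have "\<phi> \<in> Via H" using aut k g by (auto simp: Via_def inner_on_def)
  then have "separable H (twisted_conjugacy_class H \<phi> \<one>\<^bsub>H\<^esub>)"
    using sep by (simp add: Via_twisted_conjugacy_separable_def)
  then have "separable G (\<iota> ` twisted_conjugacy_class H \<phi> \<one>\<^bsub>H\<^esub>)"
    by (rule separable_image[OF assms(1-4) fin])
  then have *: "separable G {w \<in> carrier G. (\<lambda>x. x) w \<otimes>\<^bsub>G\<^esub> inv\<^bsub>G\<^esub> y \<in>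
      \<iota> ` twisted_conjugacy_class H \<phi> \<one>\<^bsub>H\<^esub>}"
    using y by (intro separable_vimage assms) (auto simp: hom_def)
  have tw: "\<iota> (\<phi> (inv\<^bsub>H\<^esub> z) \<otimes>\<^bsub>H\<^esub> \<one>\<^bsub>H\<^esub> \<otimes>\<^bsub>H\<^esub> z) \<otimes>\<^bsub>G\<^esub> y =
      inv\<^bsub>G\<^esub> (\<iota> (\<phi> z)) \<otimes>\<^bsub>G\<^esub> y \<otimes>\<^bsub>G\<^esub> \<iota> (\<phi> z)" if z: "z \<in> carrier H" for z
  proof -
    have "\<iota> (\<phi> z) = inv\<^bsub>G\<^esub> y \<otimes>\<^bsub>G\<^esub> (\<iota> z \<otimes>\<^bsub>G\<^esub> y)"
      using \<phi>[OF z] z y by (simp add: H.m_assoc)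
    then have "y \<otimes>\<^bsub>G\<^esub> \<iota> (\<phi> z) = \<iota> z \<otimes>\<^bsub>G\<^esub> y"
      using z y by (simp add: H.m_assoc[symmetric])
    moreover have "\<iota> (\<phi> (inv\<^bsub>H\<^esub> z)) = inv\<^bsub>G\<^esub> (\<iota> (\<phi> z))"
      using z y by (simp add: \<phi> H.inv_mult_group H.m_assoc)
    ultimately show ?thesis using z y \<phi>c by (simp add: H.m_assoc)
  qed
  \<comment> \<open>The twisted action of \<open>z\<close> matches conjugation by \<open>\<phi> z\<close>,
    so surjectivity of \<open>\<phi>\<close> is what makes all conjugators occur.\<close>
  have sur: "\<phi> ` carrier H = carrier H" using autoD(2)[OF aut] by (simp add: bij_betw_def)
  have "{w \<in> carrier G. w \<otimes>\<^bsub>G\<^esub> inv\<^bsub>G\<^esub> y \<in> \<iota> ` twisted_conjugacy_class H \<phi> \<one>\<^bsub>H\<^esub>} =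
      {inv\<^bsub>G\<^esub> n \<otimes>\<^bsub>G\<^esub> y \<otimes>\<^bsub>G\<^esub> n |n. n \<in> \<iota> ` carrier H}" (is "?A = ?B")
  proof (intro subset_antisym subsetI)
    fix w assume w: "w \<in> ?A"
    then obtain z where z: "z \<in> carrier H"
      "w \<otimes>\<^bsub>G\<^esub> inv\<^bsub>G\<^esub> y = \<iota> (\<phi> (inv\<^bsub>H\<^esub> z) \<otimes>\<^bsub>H\<^esub> \<one>\<^bsub>H\<^esub> \<otimes>\<^bsub>H\<^esub> z)"
      unfolding twisted_conjugacy_class_def by blast
    have "w = (w \<otimes>\<^bsub>G\<^esub> inv\<^bsub>G\<^esub> y) \<otimes>\<^bsub>G\<^esub> y" using w y by (simp add: H.m_assoc)
    also have "\<dots> = inv\<^bsub>G\<^esub> (\<iota> (\<phi> z)) \<otimes>\<^bsub>G\<^esub> y \<otimes>\<^bsub>G\<^esub> \<iota> (\<phi> z)"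
      unfolding z(2) by (rule tw[OF z(1)])
    finally show "w \<in> ?B" using \<phi>c[OF z(1)] by blast
  next
    fix w assume "w \<in> ?B"
    then obtain n where n: "n \<in> carrier H" "w = inv\<^bsub>G\<^esub> (\<iota> n) \<otimes>\<^bsub>G\<^esub> y \<otimes>\<^bsub>G\<^esub> \<iota> n" by blast
    then obtain z where z: "z \<in> carrier H" "n = \<phi> z" using sur by blast
    let ?u = "\<phi> (inv\<^bsub>H\<^esub> z) \<otimes>\<^bsub>H\<^esub> \<one>\<^bsub>H\<^esub> \<otimes>\<^bsub>H\<^esub> z"
    have u: "?u \<in> carrier H" using z \<phi>c by simp
    have w: "w = \<iota> ?u \<otimes>\<^bsub>G\<^esub> y" unfolding n(2) z(2) by (rule tw[OF z(1), symmetric])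
    have "w \<otimes>\<^bsub>G\<^esub> inv\<^bsub>G\<^esub> y = \<iota> ?u"
      unfolding w H.m_assoc[OF hom_closed[OF u] y H.inv_closed[OF y]] using u y
      by (simp del: hom_mult)
    moreover have "?u \<in> twisted_conjugacy_class H \<phi> \<one>\<^bsub>H\<^esub>"
      unfolding twisted_conjugacy_class_def using z by blast
    moreover have "w \<in> carrier G" using w hom_closed[OF u] y by simp
    ultimately show "w \<in> ?A" by blast
  qed
  then show ?thesis using * by simp
qed

text \<open>Writing a conjugator as \<open>r n\<close> with \<open>n\<close> in the normal subgroup and \<open>r\<close> in a finite set \<open>R\<close> of
  coset representatives shows that the conjugacy class of \<open>x\<close> is the union of the orbits of the
  elements \<open>r\<inverse> x r\<close>.\<close>

lemma conjugacy_separable_finite_extension: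
  assumes "group H" "Via_twisted_conjugacy_separable H" "finite_extension G H"
  shows "conjugacy_separable G"
proof -
  have "group G" using assms by (simp add: finite_extension_def)
  then interpret group G .
  obtain \<iota> where \<iota>: "\<iota> \<in> hom H G" "inj_on \<iota> (carrier H)"
    and N: "\<iota> ` carrier H \<lhd> G" and fin: "finite_index (\<iota> ` carrier H) G"
    using assms finite_extension_iff_embedding[OF assms(1) \<open>group G\<close>] by blast
  let ?N = "\<iota> ` carrier H"
  let ?O = "\<lambda>y. {inv\<^bsub>G\<^esub> n \<otimes>\<^bsub>G\<^esub> y \<otimes>\<^bsub>G\<^esub> n |n. n \<in> ?N}"
  define R where "R = (\<lambda>A. SOME r. r \<in> A) ` (rcosets\<^bsub>G\<^esub> ?N)"
  have sub: "subgroup ?N G" and R: "finite R"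
    using fin by (auto simp: finite_index_def R_def)
  have R_some: "(SOME r. r \<in> ?N #>\<^bsub>G\<^esub> z) \<in> ?N #>\<^bsub>G\<^esub> z" if "z \<in> carrier G" for z
    using rcos_self[OF that sub] by (rule someI)
  have Rc: "R \<subseteq> carrier G"
    using R_some r_coset_subset_G[OF subgroup.subset[OF sub]] by (fastforce simp: R_def RCOSETS_def)
  have dec: "\<exists>r\<in>R. \<exists>n\<in>?N. z = r \<otimes>\<^bsub>G\<^esub> n" if z: "z \<in> carrier G" for z
  proof -
    define r where "r = (SOME r. r \<in> ?N #>\<^bsub>G\<^esub> z)"
    have r: "r \<in> ?N #>\<^bsub>G\<^esub> z" unfolding r_def by (rule R_some[OF z])
    have "r \<in> R" using z unfolding R_def r_def RCOSETS_def by blast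
    moreover have "z \<in> ?N #>\<^bsub>G\<^esub> r"
      using rcos_self[OF z sub] repr_independence[OF r z sub] by simp
    then have "z \<in> r <#\<^bsub>G\<^esub> ?N" using normal.coset_eq[OF N] Rc \<open>r \<in> R\<close> by blast
    ultimately show ?thesis unfolding l_coset_def by blast
  qed
  show ?thesis unfolding conjugacy_separable_def
  proof
    fix x assume x: "x \<in> carrier G"
    have mem: "inv\<^bsub>G\<^esub> (r \<otimes>\<^bsub>G\<^esub> n) \<otimes>\<^bsub>G\<^esub> x \<otimes>\<^bsub>G\<^esub> (r \<otimes>\<^bsub>G\<^esub> n) =
        inv\<^bsub>G\<^esub> n \<otimes>\<^bsub>G\<^esub> (inv\<^bsub>G\<^esub> r \<otimes>\<^bsub>G\<^esub> x \<otimes>\<^bsub>G\<^esub> r) \<otimes>\<^bsub>G\<^esub> n"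
      if "r \<in> carrier G" "n \<in> carrier G" for r n
      using that x by (simp add: inv_mult_group m_assoc)
    have "{inv\<^bsub>G\<^esub> z \<otimes>\<^bsub>G\<^esub> x \<otimes>\<^bsub>G\<^esub> z |z. z \<in> carrier G} =
        (\<Union>r\<in>R. ?O (inv\<^bsub>G\<^esub> r \<otimes>\<^bsub>G\<^esub> x \<otimes>\<^bsub>G\<^esub> r))" (is "?C = ?U")
    proof (intro subset_antisym subsetI)
      fix w assume "w \<in> ?C"
      then obtain z where "z \<in> carrier G" "w = inv\<^bsub>G\<^esub> z \<otimes>\<^bsub>G\<^esub> x \<otimes>\<^bsub>G\<^esub> z" by blast
      moreover from this obtain r n where rn: "r \<in> R" "n \<in> ?N" "z = r \<otimes>\<^bsub>G\<^esub> n" using dec by blast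
      ultimately have "w = inv\<^bsub>G\<^esub> n \<otimes>\<^bsub>G\<^esub> (inv\<^bsub>G\<^esub> r \<otimes>\<^bsub>G\<^esub> x \<otimes>\<^bsub>G\<^esub> r) \<otimes>\<^bsub>G\<^esub> n"
        using mem Rc subgroup.mem_carrier[OF sub] by blast
      then show "w \<in> ?U" using rn by blast
    next
      fix w assume "w \<in> ?U"
      then obtain r n where rn: "r \<in> R" "n \<in> ?N"
        "w = inv\<^bsub>G\<^esub> n \<otimes>\<^bsub>G\<^esub> (inv\<^bsub>G\<^esub> r \<otimes>\<^bsub>G\<^esub> x \<otimes>\<^bsub>G\<^esub> r) \<otimes>\<^bsub>G\<^esub> n" by blast
      then have c: "r \<in> carrier G" "n \<in> carrier G" using Rc subgroup.mem_carrier[OF sub] by blast+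
      show "w \<in> ?C" unfolding rn(3) mem[OF c, symmetric] using m_closed[OF c] by blast
    qed
    moreover have "closedin (profinite_topology G) ?U"
    proof (rule closedin_Union)
      show "finite ((\<lambda>r. ?O (inv\<^bsub>G\<^esub> r \<otimes>\<^bsub>G\<^esub> x \<otimes>\<^bsub>G\<^esub> r)) ` R)" using R by simp
      fix S assume "S \<in> (\<lambda>r. ?O (inv\<^bsub>G\<^esub> r \<otimes>\<^bsub>G\<^esub> x \<otimes>\<^bsub>G\<^esub> r)) ` R"
      then obtain r where r: "r \<in> R" "S = ?O (inv\<^bsub>G\<^esub> r \<otimes>\<^bsub>G\<^esub> x \<otimes>\<^bsub>G\<^esub> r)" by blast
      then have "inv\<^bsub>G\<^esub> r \<otimes>\<^bsub>G\<^esub> x \<otimes>\<^bsub>G\<^esub> r \<in> carrier G" using Rc x by blast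
      then show "closedin (profinite_topology G) S"
        using separable_orbit_normal_subgroup[OF assms(1) \<open>group G\<close> \<iota> N fin assms(2)] r
        by (simp add: separable_def)
    qed
    ultimately show "separable G ?C" by (simp add: separable_def)
  qed
qed

section \<open>Realising a virtually inner automorphism by conjugation\<close>

text \<open>If \<open>\<phi>\<^sup>k\<close> is conjugation by \<open>g\<close>, then \<open>\<phi>\<^sup>k\<close> is also conjugation by each \<open>\<phi>\<^sup>n(g)\<close>, because it commutes
  with \<open>\<phi>\<^sup>n\<close>. Hence the product \<open>P n = g \<phi>(g) \<dots> \<phi>\<^sup>n\<^sup>-\<^sup>1(g)\<close> induces the \<open>k n\<close>-th power of \<open>\<phi>\<close>. Moreover
  \<open>g \<phi>(P n) = P (n + 1)\<close>, and for \<open>n = k\<close> the last factor of \<open>P (k + 1)\<close> is \<open>\<phi>\<^sup>k(g) = g\<close>. Thus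
  \<open>g \<phi>(P k) = (P k) g\<close>, and \<open>g\<close> commutes with \<open>P k\<close>, so \<open>\<phi>\<close> fixes \<open>P k\<close>. The relation between \<open>\<phi>\<^sup>m\<close>
  and conjugation is stated without inverses.\<close>

lemma Via_power_conj_fixed:
  fixes H :: "'a monoid" (structure)
  assumes "group H" and via: "\<phi> \<in> Via H"
  shows "\<exists>m>0. \<exists>h\<in>carrier H. \<phi> h = h \<and> (\<forall>x\<in>carrier H. x \<otimes> h = h \<otimes> (\<phi> ^^ m) x)"
proof -
  interpret group H by fact
  have aut: "\<phi> \<in> auto H" using via by (simp add: Via_def)
  obtain k g where k: "k > 0" and g: "g \<in> carrier H"
    and inn: "\<And>x. x \<in> carrier H \<Longrightarrow> (\<phi> ^^ k) x = inv g \<otimes> x \<otimes> g"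
    using via by (auto simp: Via_def inner_on_def)
  have pc: "(\<phi> ^^ n) x \<in> carrier H" if "x \<in> carrier H" for n x
    using hom_in_carrier[OF funpow_auto(1)[OF assms(1) aut] that] .
  have pm: "(\<phi> ^^ n) (x \<otimes> y) = (\<phi> ^^ n) x \<otimes> (\<phi> ^^ n) y"
    if "x \<in> carrier H" "y \<in> carrier H" for n x y
    using hom_mult[OF funpow_auto(1)[OF assms(1) aut] that] .
  have ps: "\<exists>w\<in>carrier H. x = (\<phi> ^^ n) w" if "x \<in> carrier H" for n x
    using funpow_auto(2)[OF assms(1) aut, of n] that unfolding bij_betw_def by blast
  have p1: "(\<phi> ^^ n) \<one> = \<one>" for n
    using hom_one[OF funpow_auto(1)[OF assms(1) aut] assms(1) assms(1)] .
  have swap: "(\<phi> ^^ a) ((\<phi> ^^ b) x) = (\<phi> ^^ b) ((\<phi> ^^ a) x)" for a b x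
    by (metis add.commute comp_apply funpow_add)
  have g_comm: "x \<otimes> g = g \<otimes> (\<phi> ^^ k) x" if "x \<in> carrier H" for x
    using that g by (simp add: inn m_assoc[symmetric])
  have gn_comm: "x \<otimes> (\<phi> ^^ n) g = (\<phi> ^^ n) g \<otimes> (\<phi> ^^ k) x" if x: "x \<in> carrier H" for x n
  proof -
    obtain w where w: "w \<in> carrier H" "x = (\<phi> ^^ n) w" using ps[OF x] by blast
    have "x \<otimes> (\<phi> ^^ n) g = (\<phi> ^^ n) (g \<otimes> (\<phi> ^^ k) w)"
      unfolding w(2) g_comm[OF w(1), symmetric] using w(1) g by (simp add: pm)
    then show ?thesis using w g by (simp add: pm pc swap[of k n])
  qed
  define P where "P = rec_nat \<one> (\<lambda>n p. p \<otimes> (\<phi> ^^ n) g)"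
  have P0: "P 0 = \<one>" and PS: "P (Suc n) = P n \<otimes> (\<phi> ^^ n) g" for n by (simp_all add: P_def)
  have Pc: "P n \<in> carrier H" for n by (induction n) (simp_all add: P0 PS pc g)
  have P_comm: "x \<otimes> P n = P n \<otimes> (\<phi> ^^ (k * n)) x" if x: "x \<in> carrier H" for x n
  proof (induction n)
    case 0 then show ?case using x by (simp add: P0)
  next
    case (Suc n)
    have "x \<otimes> P (Suc n) = x \<otimes> P n \<otimes> (\<phi> ^^ n) g" using x g Pc pc by (simp add: PS m_assoc)
    also have "\<dots> = P n \<otimes> ((\<phi> ^^ (k * n)) x \<otimes> (\<phi> ^^ n) g)"
      using x g Pc pc by (simp add: Suc m_assoc)
    also have "\<dots> = P n \<otimes> ((\<phi> ^^ n) g \<otimes> (\<phi> ^^ (k * Suc n)) x)"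
      using gn_comm[OF pc[OF x]] by (simp add: funpow_add)
    finally show ?case using x g Pc pc by (simp add: PS m_assoc)
  qed
  have shift: "g \<otimes> \<phi> (P n) = P (Suc n)" for n
  proof (induction n)
    case 0 then show ?case using g p1[of 1] by (simp add: P0 PS)
  next
    case (Suc n)
    have "\<phi> (P (Suc n)) = \<phi> (P n) \<otimes> (\<phi> ^^ Suc n) g"
      using pm[of "P n" "(\<phi> ^^ n) g" 1] Pc pc g by (simp add: PS)
    moreover have "\<phi> (P n) \<in> carrier H" using pc[OF Pc, of 1 n] by simp
    ultimately have "g \<otimes> \<phi> (P (Suc n)) = g \<otimes> \<phi> (P n) \<otimes> (\<phi> ^^ Suc n) g"
      using g pc[OF g, of "Suc n"] by (simp add: m_assoc)
    then show ?case by (simp only: Suc PS)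
  qed
  have gg: "(\<phi> ^^ k) g = g" using g by (simp add: inn)
  have "(\<phi> ^^ k) (P n) = P n" for n
  proof (induction n)
    case 0 then show ?case by (simp add: P0 p1)
  next
    case (Suc n)
    then show ?case using g by (simp add: PS pm pc Pc swap[of k n] gg)
  qed
  then have "P k \<otimes> g = g \<otimes> P k" using g_comm[OF Pc, of k] by simp
  then have "g \<otimes> \<phi> (P k) = g \<otimes> P k" by (simp add: shift PS gg)
  then have "\<phi> (P k) = P k" using g Pc pc[OF Pc, of 1 k] by simp
  then have "\<phi> (P k) = P k \<and> (\<forall>x\<in>carrier H. x \<otimes> P k = P k \<otimes> (\<phi> ^^ (k * k)) x)"
    using P_comm by blast
  then have "\<exists>h\<in>carrier H. \<phi> h = h \<and> (\<forall>x\<in>carrier H. x \<otimes> h = h \<otimes> (\<phi> ^^ (k * k)) x)"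
    by (rule bexI[OF _ Pc])
  moreover have "0 < k * k" using k by simp
  ultimately show ?thesis by (intro exI[of _ "k * k"] conjI)
qed

text \<open>The pair \<open>(i, x)\<close> stands for \<open>t\<^sup>i x\<close> in the group generated by \<open>H\<close> and \<open>t\<close> subject to
  \<open>t\<inverse> x t = \<phi>(x)\<close> and \<open>t\<^sup>m = h\<close>: moving \<open>t\<^sup>j\<close> to the left past \<open>x\<close> applies \<open>\<phi>\<^sup>j\<close>, and a carry in the
  exponent modulo \<open>m\<close> turns into a factor \<open>h\<close>.\<close>

definition cyclic_extension :: "'a monoid \<Rightarrow> ('a \<Rightarrow> 'a) \<Rightarrow> nat \<Rightarrow> 'a \<Rightarrow> (nat \<times> 'a) monoid"
  where "cyclic_extension H \<phi> m h =
    \<lparr>carrier = {..<m} \<times> carrier H,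
     mult = (\<lambda>(i, x) (j, y). ((i + j) mod m,
       h [^]\<^bsub>H\<^esub> ((i + j) div m) \<otimes>\<^bsub>H\<^esub> ((\<phi> ^^ j) x \<otimes>\<^bsub>H\<^esub> y))),
     one = (0, \<one>\<^bsub>H\<^esub>)\<rparr>"

text \<open>Under these conditions the multiplication above is a group law.\<close>

locale inner_power_automorphism = group H for H :: "'a monoid" (structure) +
  fixes \<phi> :: "'a \<Rightarrow> 'a" and m :: nat and h :: 'a
  assumes aut: "\<phi> \<in> auto H" and m_pos: "0 < m" and h: "h \<in> carrier H" and fixed: "\<phi> h = h"
    and h_comm: "x \<in> carrier H \<Longrightarrow> x \<otimes> h = h \<otimes> (\<phi> ^^ m) x"
begin

lemma pow_closed [simp]: "x \<in> carrier H \<Longrightarrow> (\<phi> ^^ n) x \<in> carrier H"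
  using hom_in_carrier[OF funpow_auto(1)[OF group_axioms aut]] .

lemma phi_closed [simp]: "x \<in> carrier H \<Longrightarrow> \<phi> x \<in> carrier H"
  using pow_closed[of x 1] by simp

lemma pow_mult:
  "x \<in> carrier H \<Longrightarrow> y \<in> carrier H \<Longrightarrow> (\<phi> ^^ n) (x \<otimes> y) = (\<phi> ^^ n) x \<otimes> (\<phi> ^^ n) y"
  using hom_mult[OF funpow_auto(1)[OF group_axioms aut]] .

lemma pow_one [simp]: "(\<phi> ^^ n) \<one> = \<one>"
  using hom_one[OF funpow_auto(1)[OF group_axioms aut] group_axioms group_axioms] .

lemma ex_pow_eq: "x \<in> carrier H \<Longrightarrow> \<exists>w\<in>carrier H. (\<phi> ^^ n) w = x"
  using funpow_auto(2)[OF group_axioms aut, of n] unfolding bij_betw_def by (metis imageE)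

lemma pow_h [simp]: "(\<phi> ^^ n) (h [^] (c::nat)) = h [^] c"
proof (induction c)
  case (Suc c)
  have "(\<phi> ^^ n) h = h" by (induction n) (simp_all add: fixed)
  then show ?case using h by (simp add: Suc pow_mult)
qed simp

lemma h_pow_comm: "x \<in> carrier H \<Longrightarrow> x \<otimes> h [^] (c::nat) = h [^] c \<otimes> (\<phi> ^^ (m * c)) x"
proof (induction c)
  case (Suc c)
  have "x \<otimes> h [^] Suc c = h [^] c \<otimes> ((\<phi> ^^ (m * c)) x \<otimes> h)"
    using Suc h by (simp add: m_assoc[symmetric])
  also have "\<dots> = h [^] c \<otimes> (h \<otimes> (\<phi> ^^ (m * Suc c)) x)"
    using Suc.prems by (simp add: h_comm funpow_add)
  finally show ?case using Suc.prems h by (simp add: m_assoc)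
qed simp

lemma funpow_funpow_mod: "(\<phi> ^^ (m * ((j + k) div m))) ((\<phi> ^^ ((j + k) mod m)) x) = (\<phi> ^^ (j + k)) x"
  by (metis comp_apply funpow_add mult_div_mod_eq)

abbreviation "E \<equiv> cyclic_extension H \<phi> m h"

lemma carrier_E: "carrier E = {..<m} \<times> carrier H"
  and one_E: "\<one>\<^bsub>E\<^esub> = (0, \<one>)"
  and mult_E: "(i, x) \<otimes>\<^bsub>E\<^esub> (j, y) =
    ((i + j) mod m, h [^] ((i + j) div m) \<otimes> ((\<phi> ^^ j) x \<otimes> y))"
  by (simp_all add: cyclic_extension_def)

text \<open>Both sides reduce to \<open>h\<^sup>c \<phi>\<^sup>j\<^sup>+\<^sup>k(x) \<phi>\<^sup>k(y) z\<close>, where \<open>c\<close> is the quotient of \<open>i + j + k\<close> by \<open>m\<close>. On the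
  left this uses that \<open>\<phi>\<close> fixes \<open>h\<close>, on the right that moving powers of \<open>h\<close> to the left makes up for
  reducing \<open>j + k\<close> modulo \<open>m\<close>.\<close>

lemma E_assoc:
  assumes "x \<in> carrier H" "y \<in> carrier H" "z \<in> carrier H"
  shows "((i, x) \<otimes>\<^bsub>E\<^esub> (j, y)) \<otimes>\<^bsub>E\<^esub> (k, z) = (i, x) \<otimes>\<^bsub>E\<^esub> ((j, y) \<otimes>\<^bsub>E\<^esub> (k, z))"
proof -
  let ?a = "(i + j) div m" and ?b = "((i + j) mod m + k) div m"
  let ?c = "(j + k) div m" and ?d = "(i + (j + k) mod m) div m"
  have carry: "(a mod m + b) div m + a div m = (a + b) div m" for a b
  proof -
    have "a + b = (a mod m + b) + m * (a div m)" by simp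
    then show ?thesis using m_pos div_mult_self2[of m "a mod m + b" "a div m"] by simp
  qed
  have exps: "?b + ?a = ?d + ?c"
    using carry[of "i + j" k] carry[of "j + k" i] by (simp add: add_ac)
  have idx: "((i + j) mod m + k) mod m = (i + (j + k) mod m) mod m"
    by (simp add: mod_simps add.assoc)
  let ?r = "(\<phi> ^^ (j + k)) x \<otimes> ((\<phi> ^^ k) y \<otimes> z)"
  have "h [^] ?b \<otimes> ((\<phi> ^^ k) (h [^] ?a \<otimes> ((\<phi> ^^ j) x \<otimes> y)) \<otimes> z) = h [^] ?b \<otimes> h [^] ?a \<otimes> ?r"
    using assms h by (simp add: pow_mult m_assoc add.commute[of j k] funpow_add)
  also have "\<dots> = h [^] ?d \<otimes> h [^] ?c \<otimes> ?r"
    using h by (simp only: nat_pow_mult exps)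
  also have "\<dots> = h [^] ?d \<otimes> ((h [^] ?c \<otimes> (\<phi> ^^ (j + k)) x) \<otimes> ((\<phi> ^^ k) y \<otimes> z))"
    using assms h by (simp add: m_assoc)
  also have "h [^] ?c \<otimes> (\<phi> ^^ (j + k)) x = (\<phi> ^^ ((j + k) mod m)) x \<otimes> h [^] ?c"
    using assms by (simp add: h_pow_comm funpow_funpow_mod)
  also have "h [^] ?d \<otimes> (((\<phi> ^^ ((j + k) mod m)) x \<otimes> h [^] ?c) \<otimes> ((\<phi> ^^ k) y \<otimes> z)) =
      h [^] ?d \<otimes> ((\<phi> ^^ ((j + k) mod m)) x \<otimes> (h [^] ?c \<otimes> ((\<phi> ^^ k) y \<otimes> z)))"
    using assms h by (simp add: m_assoc)
  finally show ?thesis by (simp add: mult_E idx)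
qed

lemma group_E: "group E"
proof (rule groupI)
  fix a b assume "a \<in> carrier E" "b \<in> carrier E"
  then show "a \<otimes>\<^bsub>E\<^esub> b \<in> carrier E"
    using h m_pos by (auto simp: carrier_E mult_E)
next
  show "\<one>\<^bsub>E\<^esub> \<in> carrier E" using m_pos by (simp add: carrier_E one_E)
next
  fix a b c assume "a \<in> carrier E" "b \<in> carrier E" "c \<in> carrier E"
  then show "a \<otimes>\<^bsub>E\<^esub> b \<otimes>\<^bsub>E\<^esub> c = a \<otimes>\<^bsub>E\<^esub> (b \<otimes>\<^bsub>E\<^esub> c)"
    using E_assoc by (auto simp: carrier_E)
next
  fix a assume "a \<in> carrier E"
  then show "\<one>\<^bsub>E\<^esub> \<otimes>\<^bsub>E\<^esub> a = a" by (auto simp: carrier_E one_E mult_E)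
next
  fix a assume "a \<in> carrier E"
  then obtain i x where a: "a = (i, x)" "i < m" "x \<in> carrier H" by (auto simp: carrier_E)
  let ?j = "(m - i) mod m"
  let ?p = "h [^] ((?j + i) div m)"
  have p: "?p \<in> carrier H" using h by simp
  obtain w where w: "w \<in> carrier H" "(\<phi> ^^ i) w = inv ?p \<otimes> inv x"
    using ex_pow_eq a(3) p by (metis inv_closed m_closed)
  have "(?j + i) mod m = 0" using a(2) by (simp add: mod_simps)
  moreover have "?p \<otimes> ((\<phi> ^^ i) w \<otimes> x) = \<one>" unfolding w(2) using p a(3) by (simp add: m_assoc)
  ultimately have "(?j, w) \<otimes>\<^bsub>E\<^esub> a = \<one>\<^bsub>E\<^esub>" by (simp add: a(1) mult_E one_E)
  moreover have "(?j, w) \<in> carrier E" using w m_pos by (simp add: carrier_E)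
  ultimately show "\<exists>b\<in>carrier E. b \<otimes>\<^bsub>E\<^esub> a = \<one>\<^bsub>E\<^esub>" by blast
qed

lemma ex_extension_realizing:
  "\<exists>(F :: (nat \<times> 'a) monoid) \<iota> t. group F \<and> \<iota> \<in> hom H F \<and> inj_on \<iota> (carrier H) \<and> t \<in> carrier F \<and>
    (\<forall>z\<in>carrier H. \<iota> z \<otimes>\<^bsub>F\<^esub> t = t \<otimes>\<^bsub>F\<^esub> \<iota> (\<phi> z)) \<and>
    (\<forall>e\<in>carrier F. \<exists>i<m. \<exists>n\<in>carrier H. e = t [^]\<^bsub>F\<^esub> i \<otimes>\<^bsub>F\<^esub> \<iota> n)"
proof -
  define \<iota> where "\<iota> x = (0::nat, x)" for x :: 'a
  \<comment> \<open>Normalising \<open>(1, \<one>)\<close> in this way also covers \<open>m = 1\<close>, where \<open>t\<close> is \<open>h\<close> itself.\<close>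
  define t where "t = (1 mod m, h [^] (1 div m))"
  have t: "t \<in> carrier E" using m_pos h by (simp add: t_def carrier_E)
  interpret E: group E by (rule group_E)
  have "\<iota> \<in> hom H E" using m_pos by (auto simp: hom_def \<iota>_def carrier_E mult_E)
  moreover have "inj_on \<iota> (carrier H)" by (simp add: inj_on_def \<iota>_def)
  moreover have "\<iota> z \<otimes>\<^bsub>E\<^esub> t = t \<otimes>\<^bsub>E\<^esub> \<iota> (\<phi> z)" if z: "z \<in> carrier H" for z
  proof -
    have "(\<phi> ^^ (1 mod m)) z \<otimes> h [^] (1 div m) = h [^] (1 div m) \<otimes> \<phi> z"
      using funpow_funpow_mod[of 0 1 z] h_pow_comm[OF pow_closed[OF z, of "1 mod m"], of "1 div m"]
      by simp
    then show ?thesis using z h by (simp add: \<iota>_def t_def mult_E)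
  qed
  moreover have "\<exists>i<m. \<exists>n\<in>carrier H. e = t [^]\<^bsub>E\<^esub> i \<otimes>\<^bsub>E\<^esub> \<iota> n" if e: "e \<in> carrier E" for e
  proof -
    have t_pow: "t [^]\<^bsub>E\<^esub> i = (i, \<one>)" if "i < m" for i
      using that
    proof (induction i)
      case 0 then show ?case by (simp add: one_E)
    next
      case (Suc i) then show ?case using pow_one[of 1] by (simp add: t_def mult_E)
    qed
    obtain i n where "e = (i, n)" "i < m" "n \<in> carrier H" using e by (auto simp: carrier_E)
    then show ?thesis by (intro exI[of _ i] conjI bexI[of _ n]) (simp_all add: t_pow \<iota>_def mult_E)
  qed
  ultimately show ?thesis using group_E t by blast
qed

end


text \<open>Conjugation by \<open>t\<close> and its inverse preserves \<open>H\<close>, the latter because \<open>\<phi>\<close> is surjective; so \<open>H\<close> is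
  normal. Its cosets are represented by the first \<open>m\<close> powers of \<open>t\<close>.\<close>

lemma finite_extension_of_cyclic_decomposition:
  fixes m :: nat
  assumes "group H" "group E" "\<iota> \<in> hom H E" and inj: "inj_on \<iota> (carrier H)"
    and t: "t \<in> carrier E" and aut: "\<phi> \<in> auto H"
    and conj: "\<And>z. z \<in> carrier H \<Longrightarrow> \<iota> z \<otimes>\<^bsub>E\<^esub> t = t \<otimes>\<^bsub>E\<^esub> \<iota> (\<phi> z)"
    and dec: "\<And>e. e \<in> carrier E \<Longrightarrow> \<exists>i<m. \<exists>n\<in>carrier H. e = t [^]\<^bsub>E\<^esub> i \<otimes>\<^bsub>E\<^esub> \<iota> n"
  shows "finite_extension E H"
proof -
  interpret group_hom H E \<iota>
    using assms by (simp add: group_hom_def group_hom_axioms_def)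
  let ?N = "\<iota> ` carrier H"
  have sub: "subgroup ?N E" using img_is_subgroup .
  have conj': "\<iota> (\<phi> z) = inv\<^bsub>E\<^esub> t \<otimes>\<^bsub>E\<^esub> \<iota> z \<otimes>\<^bsub>E\<^esub> t" if z: "z \<in> carrier H" for z
  proof -
    have "\<iota> (\<phi> z) \<in> carrier E" using hom_in_carrier[OF autoD(1)[OF aut] z] by simp
    then show ?thesis
      using z t by (simp add: H.m_assoc conj, simp add: H.m_assoc[symmetric])
  qed
  have t_conj: "t [^]\<^bsub>E\<^esub> i \<otimes>\<^bsub>E\<^esub> \<iota> n \<otimes>\<^bsub>E\<^esub> inv\<^bsub>E\<^esub> (t [^]\<^bsub>E\<^esub> i) \<in> ?N"
    if n: "n \<in> carrier H" for i :: nat and n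
  proof -
    obtain w where w: "w \<in> carrier H" "n = (\<phi> ^^ i) w"
      using funpow_auto(2)[OF assms(1) aut, of i] n unfolding bij_betw_def by (metis imageE)
    have ti: "t [^]\<^bsub>E\<^esub> i \<in> carrier E" using t by simp
    have n_eq: "\<iota> n = inv\<^bsub>E\<^esub> (t [^]\<^bsub>E\<^esub> i) \<otimes>\<^bsub>E\<^esub> \<iota> w \<otimes>\<^bsub>E\<^esub> t [^]\<^bsub>E\<^esub> i"
      unfolding w(2) by (rule funpow_conj[OF assms(1-3) t aut _ w(1)], rule conj')
    have "t [^]\<^bsub>E\<^esub> i \<otimes>\<^bsub>E\<^esub> \<iota> n \<otimes>\<^bsub>E\<^esub> inv\<^bsub>E\<^esub> (t [^]\<^bsub>E\<^esub> i) = \<iota> w"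
      unfolding n_eq using w(1) ti
      by (simp add: H.m_assoc, simp add: H.m_assoc[symmetric])
    then show ?thesis using w(1) by simp
  qed
  have "?N \<lhd> E"
    unfolding H.normal_inv_iff
  proof (intro conjI ballI sub)
    fix e a assume ea: "e \<in> carrier E" "a \<in> ?N"
    obtain i n where e: "n \<in> carrier H" "e = t [^]\<^bsub>E\<^esub> (i::nat) \<otimes>\<^bsub>E\<^esub> \<iota> n"
      using dec[OF ea(1)] by blast
    obtain z where z: "z \<in> carrier H" "a = \<iota> z" using ea(2) by blast
    have "e \<otimes>\<^bsub>E\<^esub> a \<otimes>\<^bsub>E\<^esub> inv\<^bsub>E\<^esub> e =
        t [^]\<^bsub>E\<^esub> i \<otimes>\<^bsub>E\<^esub> \<iota> (n \<otimes>\<^bsub>H\<^esub> z \<otimes>\<^bsub>H\<^esub> inv\<^bsub>H\<^esub> n) \<otimes>\<^bsub>E\<^esub> inv\<^bsub>E\<^esub> (t [^]\<^bsub>E\<^esub> i)"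
      using e z t by (simp add: H.inv_mult_group H.m_assoc)
    moreover have "n \<otimes>\<^bsub>H\<^esub> z \<otimes>\<^bsub>H\<^esub> inv\<^bsub>H\<^esub> n \<in> carrier H" using e(1) z(1) by simp
    ultimately show "e \<otimes>\<^bsub>E\<^esub> a \<otimes>\<^bsub>E\<^esub> inv\<^bsub>E\<^esub> e \<in> ?N" by (simp only: t_conj)
  qed
  moreover have "rcosets\<^bsub>E\<^esub> ?N \<subseteq> (\<lambda>i::nat. ?N #>\<^bsub>E\<^esub> t [^]\<^bsub>E\<^esub> i) ` {..<m}"
  proof
    fix A assume "A \<in> rcosets\<^bsub>E\<^esub> ?N"
    then obtain e where e: "e \<in> carrier E" "A = ?N #>\<^bsub>E\<^esub> e" by (auto simp: RCOSETS_def)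
    obtain i n where i: "i < m" and n: "n \<in> carrier H" "e = t [^]\<^bsub>E\<^esub> i \<otimes>\<^bsub>E\<^esub> \<iota> n"
      using dec[OF e(1)] by blast
    have "e = (t [^]\<^bsub>E\<^esub> i \<otimes>\<^bsub>E\<^esub> \<iota> n \<otimes>\<^bsub>E\<^esub> inv\<^bsub>E\<^esub> (t [^]\<^bsub>E\<^esub> i)) \<otimes>\<^bsub>E\<^esub> t [^]\<^bsub>E\<^esub> i"
      using n t by (simp add: H.m_assoc)
    then have "e \<in> ?N #>\<^bsub>E\<^esub> t [^]\<^bsub>E\<^esub> i"
      using t_conj[OF n(1), of i] unfolding r_coset_def by blast
    then have "A = ?N #>\<^bsub>E\<^esub> t [^]\<^bsub>E\<^esub> i"
      using H.repr_independence[OF _ _ sub] e(2) t by simp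
    then show "A \<in> (\<lambda>i::nat. ?N #>\<^bsub>E\<^esub> t [^]\<^bsub>E\<^esub> i) ` {..<m}"
      by (rule image_eqI) (use i in simp)
  qed
  then have "finite_index ?N E" using sub by (auto simp: finite_index_def intro: finite_subset)
  ultimately show ?thesis
    using finite_extension_iff_embedding[OF assms(1,2)] assms(3) inj by blast
qed

section \<open>Twisted conjugacy classes as conjugacy classes\<close>

text \<open>The twisted action of \<open>y\<inverse>\<close> carries \<open>y\<close> to \<open>\<phi>(y) y y\<inverse> = \<phi>(y)\<close>.\<close>

lemma funpow_mem_twisted_conjugacy_class:
  assumes "group H" "\<phi> \<in> auto H" "x \<in> carrier H"
  shows "\<exists>w\<in>carrier H. (\<phi> ^^ i) x = \<phi> (inv\<^bsub>H\<^esub> w) \<otimes>\<^bsub>H\<^esub> x \<otimes>\<^bsub>H\<^esub> w"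
proof -
  interpret group_hom H H \<phi>
    using assms autoD(1)[OF assms(2)] by (simp add: group_hom_def group_hom_axioms_def)
  show ?thesis
  proof (induction i)
    case 0
    then show ?case using assms(3) by (intro bexI[of _ "\<one>\<^bsub>H\<^esub>"]) simp_all
  next
    case (Suc i)
    then obtain w where w: "w \<in> carrier H" "(\<phi> ^^ i) x = \<phi> (inv\<^bsub>H\<^esub> w) \<otimes>\<^bsub>H\<^esub> x \<otimes>\<^bsub>H\<^esub> w" by blast
    let ?y = "(\<phi> ^^ i) x"
    have y: "?y \<in> carrier H" using hom_in_carrier[OF funpow_auto(1)[OF assms(1,2)] assms(3)] .
    have "\<phi> (inv\<^bsub>H\<^esub> (w \<otimes>\<^bsub>H\<^esub> inv\<^bsub>H\<^esub> ?y)) \<otimes>\<^bsub>H\<^esub> x \<otimes>\<^bsub>H\<^esub> (w \<otimes>\<^bsub>H\<^esub> inv\<^bsub>H\<^esub> ?y) =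
        \<phi> ?y \<otimes>\<^bsub>H\<^esub> (\<phi> (inv\<^bsub>H\<^esub> w) \<otimes>\<^bsub>H\<^esub> x \<otimes>\<^bsub>H\<^esub> w) \<otimes>\<^bsub>H\<^esub> inv\<^bsub>H\<^esub> ?y"
      using w(1) y assms(3) by (simp add: G.inv_mult_group G.m_assoc)
    also have "\<dots> = \<phi> ?y \<otimes>\<^bsub>H\<^esub> (?y \<otimes>\<^bsub>H\<^esub> inv\<^bsub>H\<^esub> ?y)"
      unfolding w(2)[symmetric] using y by (intro G.m_assoc) simp_all
    also have "\<dots> = \<phi> ?y" using y by simp
    finally show ?case using w(1) y
      by (intro bexI[of _ "w \<otimes>\<^bsub>H\<^esub> inv\<^bsub>H\<^esub> ?y"]) simp_all
  qed
qed

text \<open>Conjugating \<open>x t\<close> by \<open>\<phi>(z)\<close> with \<open>z \<in> H\<close> amounts to acting on \<open>x\<close> by \<open>z\<close> in the twisted way.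
  Conjugating \<open>x t\<close> by \<open>t\<^sup>i\<close> gives \<open>\<phi>\<^sup>i(x) t\<close>, and \<open>\<phi>\<^sup>i(x)\<close> lies in the twisted class of \<open>x\<close>. So
  conjugators outside \<open>H\<close> contribute nothing new.\<close>

lemma twisted_conjugacy_class_iff_conjugate:
  assumes "group H" "group E" "\<iota> \<in> hom H E" and inj: "inj_on \<iota> (carrier H)"
    and t: "t \<in> carrier E" and aut: "\<phi> \<in> auto H"
    and conj: "\<And>z. z \<in> carrier H \<Longrightarrow> \<iota> z \<otimes>\<^bsub>E\<^esub> t = t \<otimes>\<^bsub>E\<^esub> \<iota> (\<phi> z)"
    and dec: "\<And>e. e \<in> carrier E \<Longrightarrow> \<exists>i::nat. \<exists>n\<in>carrier H. e = t [^]\<^bsub>E\<^esub> i \<otimes>\<^bsub>E\<^esub> \<iota> n"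
    and x: "x \<in> carrier H" and w: "w \<in> carrier H"
  shows "w \<in> twisted_conjugacy_class H \<phi> x \<longleftrightarrow>
    \<iota> w \<otimes>\<^bsub>E\<^esub> t \<in> {inv\<^bsub>E\<^esub> z \<otimes>\<^bsub>E\<^esub> (\<iota> x \<otimes>\<^bsub>E\<^esub> t) \<otimes>\<^bsub>E\<^esub> z |z. z \<in> carrier E}"
    (is "_ \<longleftrightarrow> _ \<in> ?C")
proof -
  interpret group_hom H E \<iota>
    using assms by (simp add: group_hom_def group_hom_axioms_def)
  interpret \<phi>: group_hom H H \<phi>
    using assms autoD(1)[OF aut] by (simp add: group_hom_def group_hom_axioms_def)
  have tw: "\<iota> (\<phi> (inv\<^bsub>H\<^esub> z) \<otimes>\<^bsub>H\<^esub> y \<otimes>\<^bsub>H\<^esub> z) \<otimes>\<^bsub>E\<^esub> t =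
      inv\<^bsub>E\<^esub> (\<iota> (\<phi> z)) \<otimes>\<^bsub>E\<^esub> (\<iota> y \<otimes>\<^bsub>E\<^esub> t) \<otimes>\<^bsub>E\<^esub> \<iota> (\<phi> z)"
    if "y \<in> carrier H" "z \<in> carrier H" for y z
  proof -
    have "\<iota> y \<otimes>\<^bsub>E\<^esub> (t \<otimes>\<^bsub>E\<^esub> \<iota> (\<phi> z)) = t \<otimes>\<^bsub>E\<^esub> (\<iota> (\<phi> y) \<otimes>\<^bsub>E\<^esub> \<iota> (\<phi> z))"
      using that t conj[OF that(1)] by (simp add: H.m_assoc[symmetric])
    then show ?thesis using that t by (simp add: H.m_assoc conj)
  qed
  show ?thesis
  proof
    assume "w \<in> twisted_conjugacy_class H \<phi> x"
    then obtain z where z: "z \<in> carrier H" "w = \<phi> (inv\<^bsub>H\<^esub> z) \<otimes>\<^bsub>H\<^esub> x \<otimes>\<^bsub>H\<^esub> z"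
      unfolding twisted_conjugacy_class_def by blast
    have "\<iota> (\<phi> z) \<in> carrier E" using z(1) by simp
    then show "\<iota> w \<otimes>\<^bsub>E\<^esub> t \<in> ?C" unfolding z(2) tw[OF x z(1)] by blast
  next
    assume "\<iota> w \<otimes>\<^bsub>E\<^esub> t \<in> ?C"
    then obtain e where e: "e \<in> carrier E"
      "\<iota> w \<otimes>\<^bsub>E\<^esub> t = inv\<^bsub>E\<^esub> e \<otimes>\<^bsub>E\<^esub> (\<iota> x \<otimes>\<^bsub>E\<^esub> t) \<otimes>\<^bsub>E\<^esub> e" by blast
    obtain i :: nat and n where n: "n \<in> carrier H" "e = t [^]\<^bsub>E\<^esub> i \<otimes>\<^bsub>E\<^esub> \<iota> n"
      using dec[OF e(1)] by blast
    obtain v where v: "v \<in> carrier H" "n = \<phi> v"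
      using autoD(2)[OF aut] n(1) unfolding bij_betw_def by (metis imageE)
    let ?y = "(\<phi> ^^ i) x"
    have y: "?y \<in> carrier H" using hom_in_carrier[OF funpow_auto(1)[OF assms(1) aut] x] .
    obtain u where u: "u \<in> carrier H" "?y = \<phi> (inv\<^bsub>H\<^esub> u) \<otimes>\<^bsub>H\<^esub> x \<otimes>\<^bsub>H\<^esub> u"
      using funpow_mem_twisted_conjugacy_class[OF assms(1) aut x] by blast
    have ti: "t [^]\<^bsub>E\<^esub> i \<in> carrier E" using t by simp
    have "\<iota> x \<otimes>\<^bsub>E\<^esub> t [^]\<^bsub>E\<^esub> i = t [^]\<^bsub>E\<^esub> i \<otimes>\<^bsub>E\<^esub> \<iota> ?y"
    proof (induction i)
      case 0 then show ?case using x by simp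
    next
      case (Suc i)
      have yi: "(\<phi> ^^ i) x \<in> carrier H" using hom_in_carrier[OF funpow_auto(1)[OF assms(1) aut] x] .
      have "\<iota> x \<otimes>\<^bsub>E\<^esub> t [^]\<^bsub>E\<^esub> Suc i = (\<iota> x \<otimes>\<^bsub>E\<^esub> t [^]\<^bsub>E\<^esub> i) \<otimes>\<^bsub>E\<^esub> t"
        using x t by (simp add: H.m_assoc)
      also have "\<dots> = t [^]\<^bsub>E\<^esub> i \<otimes>\<^bsub>E\<^esub> (\<iota> ((\<phi> ^^ i) x) \<otimes>\<^bsub>E\<^esub> t)"
        using yi t by (simp add: Suc H.m_assoc)
      finally show ?case using yi t by (simp add: conj H.m_assoc)
    qed
    then have "inv\<^bsub>E\<^esub> (t [^]\<^bsub>E\<^esub> i) \<otimes>\<^bsub>E\<^esub> (\<iota> x \<otimes>\<^bsub>E\<^esub> t [^]\<^bsub>E\<^esub> i) = \<iota> ?y"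
      using ti y by (simp add: H.m_assoc[symmetric])
    moreover have "t \<otimes>\<^bsub>E\<^esub> t [^]\<^bsub>E\<^esub> i = t [^]\<^bsub>E\<^esub> i \<otimes>\<^bsub>E\<^esub> t" using H.nat_pow_Suc2[OF t, of i] by simp
    ultimately have *: "inv\<^bsub>E\<^esub> (t [^]\<^bsub>E\<^esub> i) \<otimes>\<^bsub>E\<^esub> (\<iota> x \<otimes>\<^bsub>E\<^esub> t) \<otimes>\<^bsub>E\<^esub> t [^]\<^bsub>E\<^esub> i = \<iota> ?y \<otimes>\<^bsub>E\<^esub> t"
      using x t ti by (metis H.inv_closed H.m_assoc H.m_closed hom_closed)
    have "\<iota> w \<otimes>\<^bsub>E\<^esub> t = inv\<^bsub>E\<^esub> (\<iota> n) \<otimes>\<^bsub>E\<^esub>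
        (inv\<^bsub>E\<^esub> (t [^]\<^bsub>E\<^esub> i) \<otimes>\<^bsub>E\<^esub> (\<iota> x \<otimes>\<^bsub>E\<^esub> t) \<otimes>\<^bsub>E\<^esub> t [^]\<^bsub>E\<^esub> i) \<otimes>\<^bsub>E\<^esub> \<iota> n"
      unfolding e(2) n(2) using n(1) x t ti by (simp add: H.inv_mult_group H.m_assoc)
    also have "\<dots> = inv\<^bsub>E\<^esub> (\<iota> (\<phi> v)) \<otimes>\<^bsub>E\<^esub> (\<iota> ?y \<otimes>\<^bsub>E\<^esub> t) \<otimes>\<^bsub>E\<^esub> \<iota> (\<phi> v)"
      unfolding * v(2) ..
    also have "\<dots> = \<iota> (\<phi> (inv\<^bsub>H\<^esub> v) \<otimes>\<^bsub>H\<^esub> ?y \<otimes>\<^bsub>H\<^esub> v) \<otimes>\<^bsub>E\<^esub> t"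
      by (rule tw[OF y v(1), symmetric])
    also have "\<phi> (inv\<^bsub>H\<^esub> v) \<otimes>\<^bsub>H\<^esub> ?y \<otimes>\<^bsub>H\<^esub> v =
        \<phi> (inv\<^bsub>H\<^esub> (u \<otimes>\<^bsub>H\<^esub> v)) \<otimes>\<^bsub>H\<^esub> x \<otimes>\<^bsub>H\<^esub> (u \<otimes>\<^bsub>H\<^esub> v)"
      unfolding u(2) using u(1) v(1) x by (simp add: G.inv_mult_group G.m_assoc)
    finally have "\<iota> w = \<iota> (\<phi> (inv\<^bsub>H\<^esub> (u \<otimes>\<^bsub>H\<^esub> v)) \<otimes>\<^bsub>H\<^esub> x \<otimes>\<^bsub>H\<^esub> (u \<otimes>\<^bsub>H\<^esub> v))"
      using w u(1) v(1) x t by (subst (asm) H.right_cancel) simp_all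
    then have "w = \<phi> (inv\<^bsub>H\<^esub> (u \<otimes>\<^bsub>H\<^esub> v)) \<otimes>\<^bsub>H\<^esub> x \<otimes>\<^bsub>H\<^esub> (u \<otimes>\<^bsub>H\<^esub> v)"
      by (rule inj_onD[OF inj]) (use w u(1) v(1) x in simp_all)
    then show "w \<in> twisted_conjugacy_class H \<phi> x"
      unfolding twisted_conjugacy_class_def using G.m_closed[OF u(1) v(1)] by blast
  qed
qed

lemma countable_finitely_presented:
  assumes "finitely_presented H"
  shows "countable (carrier H)"
proof -
  obtain X :: "nat set" and R where "H \<cong> presented_group X R"
    using assms by (auto simp: finitely_presented_def)
  then obtain f where f: "bij_betw f (carrier H) (carrier (presented_group X R))"
    by (auto simp: is_iso_def iso_def)
  have "carrier (presented_group X R) \<subseteq> (\<lambda>w. {(v, w). pres_eq X R v w} `` {w}) ` words X"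
    by (auto simp: presented_group_def quotient_def)
  moreover have "countable (words X)" by (simp add: words_def)
  ultimately have "countable (carrier (presented_group X R))"
    by (meson countable_image countable_subset)
  then show ?thesis using f by (metis bij_betw_def countable_image_inj_on)
qed

text \<open>The extension that realises \<open>\<phi>\<close> is built on pairs; countability of \<open>H\<close> allows it to be copied
  onto the type of the groups assumed to be conjugacy separable.\<close>

lemma Via_twisted_conjugacy_separable_if_finite_extensions:
  fixes H :: "'a monoid"
  assumes "group H" and count: "countable (carrier H)" and inf: "infinite (UNIV :: 'b set)"
    and sep: "\<And>G :: 'b monoid. finite_extension G H \<Longrightarrow> conjugacy_separable G"
  shows "Via_twisted_conjugacy_separable H"
  unfolding Via_twisted_conjugacy_separable_def
proof (intro ballI)
  fix \<phi> x assume via: "\<phi> \<in> Via H" and x: "x \<in> carrier H"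
  then have aut: "\<phi> \<in> auto H" by (simp add: Via_def)
  obtain m h where ipa: "inner_power_automorphism H \<phi> m h"
    using Via_power_conj_fixed[OF assms(1) via] aut assms(1)
    by (auto simp: inner_power_automorphism_def inner_power_automorphism_axioms_def)
  then obtain F :: "(nat \<times> 'a) monoid" and \<iota> t where F: "group F"
    and \<iota>: "\<iota> \<in> hom H F" "inj_on \<iota> (carrier H)" and t: "t \<in> carrier F"
    and conj: "\<forall>z\<in>carrier H. \<iota> z \<otimes>\<^bsub>F\<^esub> t = t \<otimes>\<^bsub>F\<^esub> \<iota> (\<phi> z)"
    and dec: "\<forall>e\<in>carrier F. \<exists>i<m. \<exists>n\<in>carrier H. e = t [^]\<^bsub>F\<^esub> i \<otimes>\<^bsub>F\<^esub> \<iota> n"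
    using inner_power_automorphism.ex_extension_realizing[OF ipa] by (elim exE conjE) (rule that)
  have "carrier F \<subseteq> (\<lambda>(i, n). t [^]\<^bsub>F\<^esub> i \<otimes>\<^bsub>F\<^esub> \<iota> n) ` ({..<m} \<times> carrier H)"
    using dec by force
  moreover have "countable ({..<m} \<times> carrier H)" using count by simp
  ultimately have "countable (carrier F)" by (meson countable_image countable_subset)
  moreover obtain b :: "nat \<Rightarrow> 'b" where "inj b" using infinite_countable_subset[OF inf] by blast
  ultimately obtain j :: "nat \<times> 'a \<Rightarrow> 'b" where j: "inj_on j (carrier F)"
    by (metis comp_inj_on countableE inj_on_subset subset_UNIV)
  define G where "G = image_group j F"
  have G: "group G" unfolding G_def by (rule group.inj_imp_image_group_is_group[OF F j])
  have iso: "j \<in> iso F G" unfolding G_def by (rule inj_imp_image_group_iso[OF j])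
  interpret j: group_hom F G j
    using F G iso by (simp add: group_hom_def group_hom_axioms_def iso_def)
  have \<iota>c: "\<iota> z \<in> carrier F" if "z \<in> carrier H" for z using hom_in_carrier[OF \<iota>(1) that] .
  have \<phi>c: "\<phi> z \<in> carrier H" if "z \<in> carrier H" for z using hom_in_carrier[OF autoD(1)[OF aut] that] .
  let ?\<iota> = "j \<circ> \<iota>" and ?t = "j t"
  have \<iota>': "?\<iota> \<in> hom H G" "inj_on ?\<iota> (carrier H)" "?t \<in> carrier G"
    using Group.hom_compose[OF \<iota>(1) j.homh] comp_inj_on[OF \<iota>(2) inj_on_subset[OF j]] \<iota>c t
    by auto
  have conj': "?\<iota> z \<otimes>\<^bsub>G\<^esub> ?t = ?t \<otimes>\<^bsub>G\<^esub> ?\<iota> (\<phi> z)" if z: "z \<in> carrier H" for z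
  proof -
    have "j (\<iota> z \<otimes>\<^bsub>F\<^esub> t) = j (t \<otimes>\<^bsub>F\<^esub> \<iota> (\<phi> z))" using conj z by simp
    then show ?thesis using z \<iota>c \<phi>c t by simp
  qed
  have dec': "\<exists>i<m. \<exists>n\<in>carrier H. e = ?t [^]\<^bsub>G\<^esub> i \<otimes>\<^bsub>G\<^esub> ?\<iota> n" if "e \<in> carrier G" for e
  proof -
    obtain f where f: "f \<in> carrier F" "e = j f"
      using \<open>e \<in> carrier G\<close> unfolding G_def image_group_carrier by (rule imageE)
    obtain i n where i: "i < m" and n: "n \<in> carrier H" and fn: "f = t [^]\<^bsub>F\<^esub> i \<otimes>\<^bsub>F\<^esub> \<iota> n"
      using bspec[OF dec f(1)] by blast
    have "e = ?t [^]\<^bsub>G\<^esub> i \<otimes>\<^bsub>G\<^esub> ?\<iota> n" unfolding f(2) fn using t \<iota>c[OF n] by (simp add: j.hom_nat_pow)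
    then show ?thesis by (intro exI[of _ i] conjI i bexI[OF _ n])
  qed
  have "conjugacy_separable G"
    by (rule sep, rule finite_extension_of_cyclic_decomposition[OF assms(1) G \<iota>' aut conj' dec'])
  then have "separable G {inv\<^bsub>G\<^esub> z \<otimes>\<^bsub>G\<^esub> (?\<iota> x \<otimes>\<^bsub>G\<^esub> ?t) \<otimes>\<^bsub>G\<^esub> z |z. z \<in> carrier G}"
    using \<iota>' x \<iota>c by (simp add: conjugacy_separable_def)
  then have "separable H {w \<in> carrier H. ?\<iota> w \<otimes>\<^bsub>G\<^esub> ?t \<in>
      {inv\<^bsub>G\<^esub> z \<otimes>\<^bsub>G\<^esub> (?\<iota> x \<otimes>\<^bsub>G\<^esub> ?t) \<otimes>\<^bsub>G\<^esub> z |z. z \<in> carrier G}}"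
    by (rule separable_vimage[OF assms(1) G \<iota>'(1,3)])
  moreover have "twisted_conjugacy_class H \<phi> x = {w \<in> carrier H. ?\<iota> w \<otimes>\<^bsub>G\<^esub> ?t \<in>
      {inv\<^bsub>G\<^esub> z \<otimes>\<^bsub>G\<^esub> (?\<iota> x \<otimes>\<^bsub>G\<^esub> ?t) \<otimes>\<^bsub>G\<^esub> z |z. z \<in> carrier G}}" (is "_ = {w \<in> _. ?P w}")
  proof -
    interpret group H by fact
    have dec'': "\<exists>i::nat. \<exists>n\<in>carrier H. e = ?t [^]\<^bsub>G\<^esub> i \<otimes>\<^bsub>G\<^esub> ?\<iota> n"
      if "e \<in> carrier G" for e
      using dec'[OF that] by blast
    have "\<phi> (inv\<^bsub>H\<^esub> z) \<otimes>\<^bsub>H\<^esub> x \<otimes>\<^bsub>H\<^esub> z \<in> carrier H" if "z \<in> carrier H" for z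
      using x that \<phi>c[OF inv_closed[OF that]] by (intro m_closed)
    then have "twisted_conjugacy_class H \<phi> x \<subseteq> carrier H"
      unfolding twisted_conjugacy_class_def by blast
    moreover have "w \<in> twisted_conjugacy_class H \<phi> x \<longleftrightarrow> ?P w" if "w \<in> carrier H" for w
      by (rule twisted_conjugacy_class_iff_conjugate[OF assms(1) G \<iota>' aut _ _ x that])
        (simp_all only: conj' dec'')
    ultimately show ?thesis by blast
  qed
  ultimately show "separable H (twisted_conjugacy_class H \<phi> x)" by (simp only:)
qed

theorem corollary4p10:
  fixes C :: "'a monoid set"
  assumes "\<And>H. H \<in> C \<Longrightarrow> finitely_presented H"
    and "infinite (UNIV :: 'b set)"
  shows "(\<forall>H\<in>C. Via_twisted_conjugacy_separable H) \<longleftrightarrow>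
    (\<forall>G\<in>(FEC C :: 'b monoid set). conjugacy_separable G)"
proof
  assume "\<forall>H\<in>C. Via_twisted_conjugacy_separable H"
  moreover have "group H" if "H \<in> C" for H
    using assms(1)[OF that] by (simp add: finitely_presented_def)
  ultimately show "\<forall>G\<in>(FEC C :: 'b monoid set). conjugacy_separable G"
    using conjugacy_separable_finite_extension unfolding FEC_def by blast
next
  assume sep: "\<forall>G\<in>(FEC C :: 'b monoid set). conjugacy_separable G"
  show "\<forall>H\<in>C. Via_twisted_conjugacy_separable H"
  proof
    fix H assume "H \<in> C"
    moreover from this have "group H" "countable (carrier H)"
      using assms(1)[of H] countable_finitely_presented[of H] by (simp_all add: finitely_presented_def)
    ultimately show "Via_twisted_conjugacy_separable H"
      using sep assms(2)
      by (intro Via_twisted_conjugacy_separable_if_finite_extensions) (auto simp: FEC_def)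
  qed
qed

end
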